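(* For every integer $r\ge 0$, the left adjoint in the adjunction $\Sigma^r:\mathsf{sSet}_*\rightleftarrows\mathsf{sSet}_*:\Omega^r$ is comonadic, and thus the comparison adjunction $\mathrm{Can}_{\mathbb{K}_r}:\mathsf{sSet}_*\rightleftarrows\mathsf{coAlg}_{\mathbb{K}_r}:V_{\mathbb{K}_r}$ is an equivalence of categories.
   Context: $\mathsf{sSet}_*$ is the category of pointed simplicial sets. Fix a simplicial model $S^1$ of the circle (a pointed simplicial set), and let $S^r=(S^1)^{\wedge r}$. Let $\Sigma=-\wedge S^1$ and $\Omega=\mathrm{Map}(S^1,-)$ (pointed mapping space), so $\Sigma^r=-\wedge S^r$ is left adjoint to $\Omega^r$ (iterates of $\Sigma$, $\Omega$). Given an adjunction $L:\mathsf{N}\rightleftarrows\mathsf{M}:R$ with unit $\eta$ and counit $\epsilon$, the associated comonad on $\mathsf{M}$ is $\mathbb{K}=(K=LR,\Delta=L\eta_R,\epsilon)$. A $\mathbb{K}$-coalgebra is a pair $(Y,\delta)$ with $\delta:Y\to KY$ in $\mathsf{M}$ such that $K\delta\circ\delta=\Delta_Y\circ\delta$ and $\epsilon_Y\circ\delta=\mathrm{id}_Y$; morphisms are morphisms in $\mathsf{M}$ commuting with coactions; they form the category $\mathsf{coAlg}_{\mathbb{K}}$. The comparison functor is $\mathrm{Can}_{\mathbb{K}}(X)=(LX,L\eta_X)$, with right adjoint $V_{\mathbb{K}}(Y,\delta)=\mathrm{equal}(R\delta,\eta_{RY}:RY\rightrightarrows RLRY)$. The functor $L$ is comonadic if $\mathrm{Can}_{\mathbb{K}}$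 is an equivalence of categories. $\mathbb{K}_r$ denotes the comonad on $\mathsf{sSet}_*$ associated to $\Sigma^r\dashv\Omega^r$. *)

theory Defs
  imports "HOL-Analysis.Analysis" "HOL-Homology.Homology"
begin

section \<open>Categories, functors, adjunctions\<close>

record ('o, 'm) cat =
  Ob :: "'o set"
  Arr :: "'m set"
  Dom :: "'m \<Rightarrow> 'o"
  Cod :: "'m \<Rightarrow> 'o"
  Id :: "'o \<Rightarrow> 'm"
  Comp :: "'m \<Rightarrow> 'm \<Rightarrow> 'm"

definition Hom :: "('o, 'm) cat \<Rightarrow> 'o \<Rightarrow> 'o \<Rightarrow> 'm set" where
  "Hom C X Y = {f \<in> Arr C. Dom C f = X \<and> Cod C f = Y}"

locale category =
  fixes C :: "('o, 'm) cat"
  assumes Dom_Ob: "f \<in> Arr C \<Longrightarrow> Dom C f \<in> Ob C"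
    and Cod_Ob: "f \<in> Arr C \<Longrightarrow> Cod C f \<in> Ob C"
    and Id_Hom: "X \<in> Ob C \<Longrightarrow> Id C X \<in> Hom C X X"
    and Comp_Hom: "f \<in> Hom C X Y \<Longrightarrow> g \<in> Hom C Y Z \<Longrightarrow> Comp C g f \<in> Hom C X Z"
    and Comp_Id: "f \<in> Hom C X Y \<Longrightarrow> Comp C f (Id C X) = f"
    and Id_Comp: "f \<in> Hom C X Y \<Longrightarrow> Comp C (Id C Y) f = f"
    and Comp_assoc: "f \<in> Hom C W X \<Longrightarrow> g \<in> Hom C X Y \<Longrightarrow> h \<in> Hom C Y Z \<Longrightarrow>
           Comp C (Comp C h g) f = Comp C h (Comp C g f)"

definition is_iso :: "('o, 'm) cat \<Rightarrow> 'm \<Rightarrow> bool" where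
  "is_iso C f \<longleftrightarrow> f \<in> Arr C \<and>
     (\<exists>g \<in> Hom C (Cod C f) (Dom C f).
        Comp C g f = Id C (Dom C f) \<and> Comp C f g = Id C (Cod C f))"

record ('o, 'm, 'p, 'n) fctr =
  on_ob :: "'o \<Rightarrow> 'p"
  on_arr :: "'m \<Rightarrow> 'n"

definition id_fctr :: "('o, 'm, 'o, 'm) fctr" where
  "id_fctr = \<lparr>on_ob = (\<lambda>X. X), on_arr = (\<lambda>f. f)\<rparr>"

definition comp_fctr ::
  "('p, 'n, 'q, 'k) fctr \<Rightarrow> ('o, 'm, 'p, 'n) fctr \<Rightarrow> ('o, 'm, 'q, 'k) fctr" where
  "comp_fctr G F = \<lparr>on_ob = on_ob G \<circ> on_ob F, on_arr = on_arr G \<circ> on_arr F\<rparr>"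

locale cat_functor = C: category C + D: category D
  for C :: "('o, 'm) cat" and D :: "('p, 'n) cat" +
  fixes F :: "('o, 'm, 'p, 'n) fctr"
  assumes on_ob_Ob: "X \<in> Ob C \<Longrightarrow> on_ob F X \<in> Ob D"
    and on_arr_Hom: "f \<in> Hom C X Y \<Longrightarrow> on_arr F f \<in> Hom D (on_ob F X) (on_ob F Y)"
    and on_arr_Id: "X \<in> Ob C \<Longrightarrow> on_arr F (Id C X) = Id D (on_ob F X)"
    and on_arr_Comp: "f \<in> Hom C X Y \<Longrightarrow> g \<in> Hom C Y Z \<Longrightarrow>
           on_arr F (Comp C g f) = Comp D (on_arr F g) (on_arr F f)"

locale nat_transformation = F: cat_functor C D F + G: cat_functor C D G
  for C :: "('o, 'm) cat" and D :: "('p, 'n) cat"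
    and F :: "('o, 'm, 'p, 'n) fctr" and G :: "('o, 'm, 'p, 'n) fctr" +
  fixes \<tau> :: "'o \<Rightarrow> 'n"
  assumes component_Hom: "X \<in> Ob C \<Longrightarrow> \<tau> X \<in> Hom D (on_ob F X) (on_ob G X)"
    and naturality: "f \<in> Hom C X Y \<Longrightarrow>
           Comp D (\<tau> Y) (on_arr F f) = Comp D (on_arr G f) (\<tau> X)"

definition nat_iso ::
  "('o, 'm) cat \<Rightarrow> ('p, 'n) cat \<Rightarrow> ('o, 'm, 'p, 'n) fctr \<Rightarrow> ('o, 'm, 'p, 'n) fctr \<Rightarrow>
   ('o \<Rightarrow> 'n) \<Rightarrow> bool" where
  "nat_iso C D F G \<tau> \<longleftrightarrow> nat_transformation C D F G \<tau> \<and> (\<forall>X \<in> Ob C. is_iso D (\<tau> X))"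

definition equivalence_of_categories ::
  "('o, 'm) cat \<Rightarrow> ('p, 'n) cat \<Rightarrow> ('o, 'm, 'p, 'n) fctr \<Rightarrow> bool" where
  "equivalence_of_categories C D F \<longleftrightarrow> cat_functor C D F \<and>
     (\<exists>G \<eta> \<epsilon>. cat_functor D C G \<and>
        nat_iso C C id_fctr (comp_fctr G F) \<eta> \<and> nat_iso D D (comp_fctr F G) id_fctr \<epsilon>)"

record ('o, 'm, 'p, 'n) adj =
  ladj :: "('o, 'm, 'p, 'n) fctr"
  radj :: "('p, 'n, 'o, 'm) fctr"
  aunit :: "'o \<Rightarrow> 'm"
  acounit :: "'p \<Rightarrow> 'n"

definition adjunction ::
  "('o, 'm) cat \<Rightarrow> ('p, 'n) cat \<Rightarrow> ('o, 'm, 'p, 'n) adj \<Rightarrow> bool" where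
  "adjunction N M A \<longleftrightarrow>
     cat_functor N M (ladj A) \<and> cat_functor M N (radj A) \<and>
     nat_transformation N N id_fctr (comp_fctr (radj A) (ladj A)) (aunit A) \<and>
     nat_transformation M M (comp_fctr (ladj A) (radj A)) id_fctr (acounit A) \<and>
     (\<forall>X \<in> Ob N. Comp M (acounit A (on_ob (ladj A) X)) (on_arr (ladj A) (aunit A X))
                   = Id M (on_ob (ladj A) X)) \<and>
     (\<forall>Y \<in> Ob M. Comp N (on_arr (radj A) (acounit A Y)) (aunit A (on_ob (radj A) Y))
                   = Id N (on_ob (radj A) Y))"

definition adjoint_equivalence ::
  "('o, 'm) cat \<Rightarrow> ('p, 'n) cat \<Rightarrow> ('o, 'm, 'p, 'n) adj \<Rightarrow> bool" where
  "adjoint_equivalence N M A \<longleftrightarrow> adjunction N M A \<and>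
     (\<forall>X \<in> Ob N. is_iso N (aunit A X)) \<and> (\<forall>Y \<in> Ob M. is_iso M (acounit A Y))"

definition id_adj :: "('o, 'm) cat \<Rightarrow> ('o, 'm, 'o, 'm) adj" where
  "id_adj C = \<lparr>ladj = id_fctr, radj = id_fctr, aunit = Id C, acounit = Id C\<rparr>"

text \<open>Composite of adjunctions \<open>A : N \<rightleftarrows> M\<close> and \<open>B : M \<rightleftarrows> P\<close>; left adjoint \<open>ladj B \<circ> ladj A\<close>.\<close>

definition comp_adj ::
  "('o, 'm) cat \<Rightarrow> ('q, 'k) cat \<Rightarrow> ('p, 'n, 'q, 'k) adj \<Rightarrow> ('o, 'm, 'p, 'n) adj \<Rightarrow>
   ('o, 'm, 'q, 'k) adj" where
  "comp_adj N P B A =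
     \<lparr>ladj = comp_fctr (ladj B) (ladj A),
      radj = comp_fctr (radj A) (radj B),
      aunit = (\<lambda>X. Comp N (on_arr (radj A) (aunit B (on_ob (ladj A) X))) (aunit A X)),
      acounit = (\<lambda>Z. Comp P (acounit B Z) (on_arr (ladj B) (acounit A (on_ob (radj B) Z))))\<rparr>"

primrec adj_power :: "('o, 'm) cat \<Rightarrow> ('o, 'm, 'o, 'm) adj \<Rightarrow> nat \<Rightarrow> ('o, 'm, 'o, 'm) adj" where
  "adj_power C A 0 = id_adj C"
| "adj_power C A (Suc r) = comp_adj C C A (adj_power C A r)"


section \<open>Comonads, coalgebras, comonadicity\<close>

record ('o, 'm) comonad =
  cofun :: "('o, 'm, 'o, 'm) fctr"
  comult :: "'o \<Rightarrow> 'm"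
  counit :: "'o \<Rightarrow> 'm"

definition comonad_of :: "('o, 'm, 'p, 'n) adj \<Rightarrow> ('p, 'n) comonad" where
  "comonad_of A =
     \<lparr>cofun = comp_fctr (ladj A) (radj A),
      comult = (\<lambda>Y. on_arr (ladj A) (aunit A (on_ob (radj A) Y))),
      counit = acounit A\<rparr>"

definition coalgebra :: "('o, 'm) cat \<Rightarrow> ('o, 'm) comonad \<Rightarrow> 'o \<times> 'm \<Rightarrow> bool" where
  "coalgebra M K = (\<lambda>(Y, \<delta>).
     Y \<in> Ob M \<and> \<delta> \<in> Hom M Y (on_ob (cofun K) Y) \<and>
     Comp M (on_arr (cofun K) \<delta>) \<delta> = Comp M (comult K Y) \<delta> \<and>
     Comp M (counit K Y) \<delta> = Id M Y)"

definition coalgebra_mor ::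
  "('o, 'm) cat \<Rightarrow> ('o, 'm) comonad \<Rightarrow> ('o \<times> 'm) \<Rightarrow> 'm \<Rightarrow> ('o \<times> 'm) \<Rightarrow> bool" where
  "coalgebra_mor M K = (\<lambda>(Y, \<delta>) f (Y', \<delta>').
     f \<in> Hom M Y Y' \<and> Comp M \<delta>' f = Comp M (on_arr (cofun K) f) \<delta>)"

definition coAlg ::
  "('o, 'm) cat \<Rightarrow> ('o, 'm) comonad \<Rightarrow> ('o \<times> 'm, ('o \<times> 'm) \<times> 'm \<times> ('o \<times> 'm)) cat" where
  "coAlg M K =
     \<lparr>Ob = {A. coalgebra M K A},
      Arr = {(A, f, B). coalgebra M K A \<and> coalgebra M K B \<and> coalgebra_mor M K A f B},
      Dom = (\<lambda>(A, f, B). A),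
      Cod = (\<lambda>(A, f, B). B),
      Id = (\<lambda>A. (A, Id M (fst A), A)),
      Comp = (\<lambda>(B', g, D) (A, f, B). (A, Comp M g f, D))\<rparr>"

definition Can ::
  "('o, 'm) cat \<Rightarrow> ('o, 'm, 'p, 'n) adj \<Rightarrow>
   ('o, 'm, 'p \<times> 'n, ('p \<times> 'n) \<times> 'n \<times> ('p \<times> 'n)) fctr" where
  "Can N A =
     (let c = (\<lambda>X. (on_ob (ladj A) X, on_arr (ladj A) (aunit A X))) in
      \<lparr>on_ob = c, on_arr = (\<lambda>f. (c (Dom N f), on_arr (ladj A) f, c (Cod N f)))\<rparr>)"

definition comonadic :: "('o, 'm) cat \<Rightarrow> ('p, 'n) cat \<Rightarrow> ('o, 'm, 'p, 'n) adj \<Rightarrow> bool" where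
  "comonadic N M A \<longleftrightarrow> equivalence_of_categories N (coAlg M (comonad_of A)) (Can N A)"

text \<open>
  The argument \<open>eqz\<close> below chooses an equalizer arrow \<open>eqz f g : equal(f, g) \<rightarrow> X\<close> for every
  parallel pair \<open>f, g : X \<rightarrow> Y\<close> of \<open>N\<close>. \<open>lift_mono N e h\<close> is the factorization of \<open>h\<close> through
  the monomorphism \<open>e\<close>.
\<close>

definition lift_mono :: "('o, 'm) cat \<Rightarrow> 'm \<Rightarrow> 'm \<Rightarrow> 'm" where
  "lift_mono N e h = (THE u. u \<in> Hom N (Dom N h) (Dom N e) \<and> Comp N e u = h)"

definition V_incl ::
  "('o, 'm, 'p, 'n) adj \<Rightarrow> ('m \<Rightarrow> 'm \<Rightarrow> 'm) \<Rightarrow> 'p \<times> 'n \<Rightarrow> 'm" where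
  "V_incl A eqz = (\<lambda>(Y, \<delta>). eqz (on_arr (radj A) \<delta>) (aunit A (on_ob (radj A) Y)))"

definition V ::
  "('o, 'm) cat \<Rightarrow> ('o, 'm, 'p, 'n) adj \<Rightarrow> ('m \<Rightarrow> 'm \<Rightarrow> 'm) \<Rightarrow>
   ('p \<times> 'n, ('p \<times> 'n) \<times> 'n \<times> ('p \<times> 'n), 'o, 'm) fctr" where
  "V N A eqz =
     \<lparr>on_ob = (\<lambda>B. Dom N (V_incl A eqz B)),
      on_arr = (\<lambda>(B, f, B').
        lift_mono N (V_incl A eqz B') (Comp N (on_arr (radj A) f) (V_incl A eqz B)))\<rparr>"

text \<open>
  The unit at \<open>X\<close> is the factorization of \<open>\<eta>\<^sub>X\<close> through the equalizer; the counit at \<open>(Y, \<delta>)\<close> is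
  the adjunct \<open>\<epsilon>\<^sub>Y \<circ> L(e)\<close> of the equalizer inclusion \<open>e : V(Y, \<delta>) \<rightarrow> RY\<close>.
\<close>

definition comparison_adj ::
  "('o, 'm) cat \<Rightarrow> ('p, 'n) cat \<Rightarrow> ('o, 'm, 'p, 'n) adj \<Rightarrow> ('m \<Rightarrow> 'm \<Rightarrow> 'm) \<Rightarrow>
   ('o, 'm, 'p \<times> 'n, ('p \<times> 'n) \<times> 'n \<times> ('p \<times> 'n)) adj" where
  "comparison_adj N M A eqz =
     \<lparr>ladj = Can N A,
      radj = V N A eqz,
      aunit = (\<lambda>X. lift_mono N (V_incl A eqz (on_ob (Can N A) X)) (aunit A X)),
      acounit = (\<lambda>B. (on_ob (Can N A) (on_ob (V N A eqz) B),
                     Comp M (acounit A (fst B)) (on_arr (ladj A) (V_incl A eqz B)),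
                     B))\<rparr>"


section \<open>Pointed simplicial sets\<close>

text \<open>Monotone maps \<open>[m] \<rightarrow> [n]\<close>, made extensional so that they are determined by their values.\<close>

definition Delta :: "nat \<Rightarrow> nat \<Rightarrow> (nat \<Rightarrow> nat) set" where
  "Delta m n = {\<theta> \<in> {..m} \<rightarrow>\<^sub>E {..n}. mono_on {..m} \<theta>}"

text \<open>
  \<open>act X m n \<theta> : X\<^sub>n \<rightarrow> X\<^sub>m\<close> is the structure map of \<open>\<theta> : [m] \<rightarrow> [n]\<close>, and \<open>pt X n\<close> is the base
  point in degree \<open>n\<close>. Values of \<open>act X m n \<theta>\<close> outside \<open>X\<^sub>n\<close> are unconstrained; two objects that
  differ only there are isomorphic through the identity on simplices.
\<close>

record 'a psset =
  cells :: "nat \<Rightarrow> 'a set"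
  act :: "nat \<Rightarrow> nat \<Rightarrow> (nat \<Rightarrow> nat) \<Rightarrow> 'a \<Rightarrow> 'a"
  pt :: "nat \<Rightarrow> 'a"

definition pointed_sset :: "'a psset \<Rightarrow> bool" where
  "pointed_sset X \<longleftrightarrow>
     (\<forall>m n. \<forall>\<theta> \<in> Delta m n. act X m n \<theta> \<in> cells X n \<rightarrow> cells X m) \<and>
     (\<forall>n. \<forall>x \<in> cells X n. act X n n (restrict id {..n}) x = x) \<and>
     (\<forall>k m n. \<forall>\<phi> \<in> Delta k m. \<forall>\<theta> \<in> Delta m n. \<forall>x \<in> cells X n.
        act X k n (compose {..k} \<theta> \<phi>) x = act X k m \<phi> (act X m n \<theta> x)) \<and>
     (\<forall>n. pt X n \<in> cells X n) \<and>
     (\<forall>m n. \<forall>\<theta> \<in> Delta m n. act X m n \<theta> (pt X n) = pt X m)"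

definition ps_maps :: "'a psset \<Rightarrow> 'b psset \<Rightarrow> (nat \<Rightarrow> 'a \<Rightarrow> 'b) set" where
  "ps_maps X Y = {f.
     (\<forall>n. f n \<in> cells X n \<rightarrow>\<^sub>E cells Y n) \<and>
     (\<forall>m n. \<forall>\<theta> \<in> Delta m n. \<forall>x \<in> cells X n. f m (act X m n \<theta> x) = act Y m n \<theta> (f n x)) \<and>
     (\<forall>n. f n (pt X n) = pt Y n)}"

definition ps_id :: "'a psset \<Rightarrow> nat \<Rightarrow> 'a \<Rightarrow> 'a" where
  "ps_id X n = restrict id (cells X n)"

definition ps_comp :: "'a psset \<Rightarrow> (nat \<Rightarrow> 'b \<Rightarrow> 'c) \<Rightarrow> (nat \<Rightarrow> 'a \<Rightarrow> 'b) \<Rightarrow> nat \<Rightarrow> 'a \<Rightarrow> 'c" where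
  "ps_comp X g f n = compose (cells X n) (g n) (f n)"

type_synonym 'a psmor = "'a psset \<times> (nat \<Rightarrow> 'a \<Rightarrow> 'a) \<times> 'a psset"

definition sSet_pt :: "('a psset, 'a psmor) cat" where
  "sSet_pt =
     \<lparr>Ob = {X. pointed_sset X},
      Arr = {(X, f, Y). pointed_sset X \<and> pointed_sset Y \<and> f \<in> ps_maps X Y},
      Dom = (\<lambda>(X, f, Y). X),
      Cod = (\<lambda>(X, f, Y). Y),
      Id = (\<lambda>X. (X, ps_id X, X)),
      Comp = (\<lambda>(Y', g, Z) (X, f, Y). (X, ps_comp X g f, Z))\<rparr>"

definition ps_equalizer :: "'a psmor \<Rightarrow> 'a psmor \<Rightarrow> 'a psmor" where
  "ps_equalizer = (\<lambda>(X, f, Y) (X', g, Y').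
     let E = X\<lparr>cells := (\<lambda>n. {x \<in> cells X n. f n x = g n x})\<rparr> in (E, ps_id E, X))"


section \<open>Smash products and pointed mapping spaces\<close>

text \<open>
  The smash product is the levelwise quotient \<open>(X\<^sub>n \<times> Y\<^sub>n) / (X\<^sub>n \<or> Y\<^sub>n)\<close>; \<open>None\<close> is the collapsed
  class, every other class is a singleton.
\<close>

definition smash_class :: "'a psset \<Rightarrow> 'b psset \<Rightarrow> nat \<Rightarrow> 'a \<Rightarrow> 'b \<Rightarrow> ('a \<times> 'b) option" where
  "smash_class X Y n x y = (if x = pt X n \<or> y = pt Y n then None else Some (x, y))"

definition smash :: "'a psset \<Rightarrow> 'b psset \<Rightarrow> ('a \<times> 'b) option psset" where
  "smash X Y =
     \<lparr>cells = (\<lambda>n. {smash_class X Y n x y | x y. x \<in> cells X n \<and> y \<in> cells Y n}),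
      act = (\<lambda>m n \<theta> z. case z of None \<Rightarrow> None
               | Some (x, y) \<Rightarrow> smash_class X Y m (act X m n \<theta> x) (act Y m n \<theta> y)),
      pt = (\<lambda>n. None)\<rparr>"

definition smash_map ::
  "'a psset \<Rightarrow> 'b psset \<Rightarrow> 'c psset \<Rightarrow> 'd psset \<Rightarrow> (nat \<Rightarrow> 'a \<Rightarrow> 'c) \<Rightarrow> (nat \<Rightarrow> 'b \<Rightarrow> 'd) \<Rightarrow>
   nat \<Rightarrow> ('a \<times> 'b) option \<Rightarrow> ('c \<times> 'd) option" where
  "smash_map X Y X' Y' f g n = (\<lambda>z \<in> cells (smash X Y) n.
     case z of None \<Rightarrow> None | Some (x, y) \<Rightarrow> smash_class X' Y' n (f n x) (g n y))"

text \<open>\<open>\<Delta>[n]\<^sub>+\<close>, with \<open>None\<close> the disjoint base point, and the map \<open>\<Delta>[m]\<^sub>+ \<rightarrow> \<Delta>[n]\<^sub>+\<close> induced by \<open>\<theta>\<close>.\<close>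

definition simplex_plus :: "nat \<Rightarrow> (nat \<Rightarrow> nat) option psset" where
  "simplex_plus n =
     \<lparr>cells = (\<lambda>k. insert None (Some ` Delta k n)),
      act = (\<lambda>j k \<phi>. map_option (\<lambda>\<alpha>. compose {..j} \<alpha> \<phi>)),
      pt = (\<lambda>k. None)\<rparr>"

definition simplex_plus_map ::
  "nat \<Rightarrow> nat \<Rightarrow> (nat \<Rightarrow> nat) \<Rightarrow> nat \<Rightarrow> (nat \<Rightarrow> nat) option \<Rightarrow> (nat \<Rightarrow> nat) option" where
  "simplex_plus_map m n \<theta> k =
     restrict (map_option (\<lambda>\<alpha>. compose {..k} \<theta> \<alpha>)) (cells (simplex_plus m) k)"

type_synonym ('s, 'a) map_cell = "nat \<Rightarrow> ('s \<times> (nat \<Rightarrow> nat) option) option \<Rightarrow> 'a"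

text \<open>\<open>Map(S, X)\<^sub>n\<close> is the set of pointed maps \<open>S \<and> \<Delta>[n]\<^sub>+ \<rightarrow> X\<close>.\<close>

definition mapping_space :: "'s psset \<Rightarrow> 'a psset \<Rightarrow> ('s, 'a) map_cell psset" where
  "mapping_space S X =
     \<lparr>cells = (\<lambda>n. ps_maps (smash S (simplex_plus n)) X),
      act = (\<lambda>m n \<theta> h. ps_comp (smash S (simplex_plus m)) h
               (smash_map S (simplex_plus m) S (simplex_plus n)
                  (ps_id S) (simplex_plus_map m n \<theta>))),
      pt = (\<lambda>n k. \<lambda>z \<in> cells (smash S (simplex_plus n)) k. pt X k)\<rparr>"

definition mapping_space_map ::
  "'s psset \<Rightarrow> 'a psset \<Rightarrow> (nat \<Rightarrow> 'a \<Rightarrow> 'b) \<Rightarrow> nat \<Rightarrow> ('s, 'a) map_cell \<Rightarrow> ('s, 'b) map_cell" where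
  "mapping_space_map S X f n =
     (\<lambda>h \<in> cells (mapping_space S X) n. ps_comp (smash S (simplex_plus n)) f h)"


section \<open>The endofunctors \<open>\<Sigma>\<close> and \<open>\<Omega>\<close>\<close>

text \<open>
  The simplices of \<open>X \<and> S\<close> and of \<open>Map(S, X)\<close> do not have the type of the simplices of \<open>X\<close>. In order
  that \<open>- \<and> S\<close> and \<open>Map(S, -)\<close> be endofunctors of one category, simplices are taken from a free
  universe: it contains the arbitrary type \<open>'v\<close> of atoms, and the injective constructors \<open>Sm\<close> and
  \<open>Fn\<close> put the simplices of \<open>X \<and> S\<close> and of \<open>Map(S, X)\<close> back into it. Every pointed simplicial set
  with simplices in \<open>'v\<close> is, through \<open>Atom\<close>, isomorphic to one with simplices in \<open>('s, 'v) univ\<close>.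
\<close>

datatype ('s, 'v) univ =
    Atom 'v
  | Sm "(('s, 'v) univ \<times> 's) option"
  | Fn "('s, ('s, 'v) univ) map_cell"

text \<open>Transport of a pointed simplicial set, or of a map, along injections of simplices.\<close>

definition ps_rename :: "('a \<Rightarrow> 'b) \<Rightarrow> 'a psset \<Rightarrow> 'b psset" where
  "ps_rename \<iota> X =
     \<lparr>cells = (\<lambda>n. \<iota> ` cells X n),
      act = (\<lambda>m n \<theta> z. \<iota> (act X m n \<theta> (inv_into UNIV \<iota> z))),
      pt = (\<lambda>n. \<iota> (pt X n))\<rparr>"

definition map_rename ::
  "('a \<Rightarrow> 'b) \<Rightarrow> ('c \<Rightarrow> 'd) \<Rightarrow> 'a psset \<Rightarrow> (nat \<Rightarrow> 'a \<Rightarrow> 'c) \<Rightarrow> nat \<Rightarrow> 'b \<Rightarrow> 'd" where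
  "map_rename \<iota> \<kappa> X f n = (\<lambda>z \<in> \<iota> ` cells X n. \<kappa> (f n (inv_into UNIV \<iota> z)))"

type_synonym ('s, 'v) uobj = "('s, 'v) univ psset"
type_synonym ('s, 'v) umor = "('s, 'v) univ psmor"

definition Susp ::
  "'s psset \<Rightarrow> (('s, 'v) uobj, ('s, 'v) umor, ('s, 'v) uobj, ('s, 'v) umor) fctr" where
  "Susp S =
     (let s = (\<lambda>X. ps_rename Sm (smash X S)) in
      \<lparr>on_ob = s,
       on_arr = (\<lambda>(X, f, Y).
         (s X, map_rename Sm Sm (smash X S) (smash_map X S Y S f (ps_id S)), s Y))\<rparr>)"

definition Loop ::
  "'s psset \<Rightarrow> (('s, 'v) uobj, ('s, 'v) umor, ('s, 'v) uobj, ('s, 'v) umor) fctr" where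
  "Loop S =
     (let l = (\<lambda>X. ps_rename Fn (mapping_space S X)) in
      \<lparr>on_ob = l,
       on_arr = (\<lambda>(X, f, Y).
         (l X, map_rename Fn Fn (mapping_space S X) (mapping_space_map S X f), l Y))\<rparr>)"

text \<open>
  The unit sends \<open>x \<in> X\<^sub>n\<close> to the map \<open>S \<and> \<Delta>[n]\<^sub>+ \<rightarrow> X \<and> S\<close>, \<open>s \<and> \<alpha> \<mapsto> \<alpha>\<^sup>*x \<and> s\<close>. The counit sends
  \<open>h \<and> s\<close>, with \<open>h : S \<and> \<Delta>[n]\<^sub>+ \<rightarrow> X\<close> and \<open>s \<in> S\<^sub>n\<close>, to \<open>h(s \<and> id\<^bsub>[n]\<^esub>)\<close>.
\<close>

definition susp_loop_unit :: "'s psset \<Rightarrow> ('s, 'v) uobj \<Rightarrow> ('s, 'v) umor" where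
  "susp_loop_unit S X =
     (X,
      \<lambda>n. \<lambda>x \<in> cells X n.
        Fn (\<lambda>k. \<lambda>z \<in> cells (smash S (simplex_plus n)) k.
          Sm (case z of Some (s, Some \<alpha>) \<Rightarrow> smash_class X S k (act X k n \<alpha> x) s | _ \<Rightarrow> None)),
      on_ob (Loop S) (on_ob (Susp S) X))"

definition susp_loop_counit :: "'s psset \<Rightarrow> ('s, 'v) uobj \<Rightarrow> ('s, 'v) umor" where
  "susp_loop_counit S X =
     (let W = on_ob (Susp S) (on_ob (Loop S) X) in
      (W,
       \<lambda>n. \<lambda>w \<in> cells W n.
         (case w of
            Sm (Some (Fn h, s)) \<Rightarrow>
              h n (smash_class S (simplex_plus n) n s (Some (restrict id {..n})))
          | _ \<Rightarrow> pt X n),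
       X))"

definition susp_loop ::
  "'s psset \<Rightarrow> (('s, 'v) uobj, ('s, 'v) umor, ('s, 'v) uobj, ('s, 'v) umor) adj" where
  "susp_loop S =
     \<lparr>ladj = Susp S, radj = Loop S, aunit = susp_loop_unit S, acounit = susp_loop_counit S\<rparr>"


section \<open>Geometric realization and simplicial models of the circle\<close>

definition quotient_topology :: "'a topology \<Rightarrow> ('a \<times> 'a) set \<Rightarrow> 'a set topology" where
  "quotient_topology T E =
     topology (\<lambda>U. U \<subseteq> topspace T // E \<and> openin T (\<Union>U))"

definition simplex_pushforward :: "nat \<Rightarrow> (nat \<Rightarrow> nat) \<Rightarrow> (nat \<Rightarrow> real) \<Rightarrow> nat \<Rightarrow> real" where
  "simplex_pushforward m \<theta> t j = (\<Sum>i | i \<le> m \<and> \<theta> i = j. t i)"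

definition realization_space :: "'a psset \<Rightarrow> ((nat \<times> 'a) \<times> (nat \<Rightarrow> real)) topology" where
  "realization_space X =
     sum_topology (\<lambda>(n, x). subtopology (powertop_real UNIV) (standard_simplex n))
       (Sigma UNIV (cells X))"

definition realization_step ::
  "'a psset \<Rightarrow> (((nat \<times> 'a) \<times> (nat \<Rightarrow> real)) \<times> ((nat \<times> 'a) \<times> (nat \<Rightarrow> real))) set" where
  "realization_step X =
     {(((m, act X m n \<theta> x), t), ((n, x), simplex_pushforward m \<theta> t)) | m n \<theta> x t.
        \<theta> \<in> Delta m n \<and> x \<in> cells X n \<and> t \<in> standard_simplex m}"

definition realization :: "'a psset \<Rightarrow> ((nat \<times> 'a) \<times> (nat \<Rightarrow> real)) set topology" where
  "realization X =
     quotient_topology (realization_space X)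
       ((realization_step X \<union> (realization_step X)\<inverse>)\<^sup>*)"

text \<open>
  Realizations are CW complexes, so homotopy equivalence with the circle is the same as weak
  homotopy equivalence.
\<close>

definition circle_model :: "'s psset \<Rightarrow> bool" where
  "circle_model S \<longleftrightarrow> pointed_sset S \<and>
     realization S homotopy_equivalent_space top_of_set (sphere (0::complex) 1)"

end

theory Submission
  imports Defs
begin

text \<open>
  The comparison adjunction of an adjunction \<open>L : N \<rightleftarrows> M : R\<close> is an equivalence as soon as \<open>L\<close>
  preserves equalizers and reflects isomorphisms, and both properties are inherited by composites, so
  it suffices to treat \<open>L = - \<and> S\<close>. Levelwise this is the smash product with a pointed set, which
  preserves equalizers, and reflects isomorphisms in every degree in which \<open>S\<close> has a simplex besides
  the base point. A circle model has such a simplex in some degree, since otherwise its realization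
  would be a point; the components of a map in the remaining low degrees are retracts of higher ones.
\<close>

subsection \<open>Composites of adjunctions\<close>

text \<open>Preservation of equalizers is not formal for a left adjoint. It holds here because a
  simplex of the smash product of X and S other than the base point is a pair of simplices, neither
  of them a base point: in degree n the smash product is a wedge of copies of the pointed set X_n,
  one for each simplex of S_n other than the base point. Bijections and solution sets can be tested
  on each copy. The criterion rests on one remark: for every coalgebra (Y, \<delta>) the arrow
  \<delta> is itself an equalizer of L(R \<delta>) and L(\<eta>), and L applied to the inclusion of
  V(Y, \<delta>) is a second equalizer of the same pair. The comparison counit lies over the arrow
  from the second to the first. For the coalgebra on LX, the image under L of the comparison unit is
  the arrow in the other direction, and reflection of isomorphisms finishes. The induction over r
  runs on a degreewise form of the equalizer property, \<open>levelwise_equalizer\<close>, which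
  \<open>Susp\<close> is shown to preserve and which implies the universal property.\<close>

lemma HomD: "f \<in> Hom C X Y \<Longrightarrow> f \<in> Arr C" "f \<in> Hom C X Y \<Longrightarrow> Dom C f = X" "f \<in> Hom C X Y \<Longrightarrow> Cod C f = Y"
  by (auto simp: Hom_def)

lemma (in category) Hom_Ob:
  assumes "f \<in> Hom C X Y"
  shows "X \<in> Ob C" "Y \<in> Ob C"
  using assms Dom_Ob Cod_Ob by (auto simp: Hom_def)

lemma is_isoI:
  assumes "f \<in> Hom C X Y" "g \<in> Hom C Y X" "Comp C g f = Id C X" "Comp C f g = Id C Y"
  shows "is_iso C f"
  using assms unfolding is_iso_def Hom_def by auto

lemma is_isoE:
  assumes "is_iso C f" "f \<in> Hom C X Y"
  obtains g where "g \<in> Hom C Y X" "Comp C g f = Id C X" "Comp C f g = Id C Y"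
  using assms unfolding is_iso_def Hom_def by auto

lemma id_fctr_simps [simp]: "on_ob id_fctr X = X" "on_arr id_fctr f = f"
  by (simp_all add: id_fctr_def)

lemma comp_fctr_simps [simp]:
  "on_ob (comp_fctr G F) X = on_ob G (on_ob F X)" "on_arr (comp_fctr G F) f = on_arr G (on_arr F f)"
  by (simp_all add: comp_fctr_def)

lemma (in category) id_cat_functor: "cat_functor C C id_fctr"
  by unfold_locales auto

lemma comp_cat_functor:
  assumes "cat_functor C D F" "cat_functor D E G"
  shows "cat_functor C E (comp_fctr G F)"
proof -
  interpret F: cat_functor C D F by fact
  interpret G: cat_functor D E G by fact
  show ?thesis
    by unfold_locales
      (auto simp: F.on_arr_Id G.on_arr_Id F.on_ob_Ob G.on_ob_Ob F.on_arr_Hom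
         intro: F.on_arr_Hom G.on_arr_Hom
         simp: F.on_arr_Comp G.on_arr_Comp[OF F.on_arr_Hom F.on_arr_Hom])
qed

lemma (in category) adjunction_id_adj: "adjunction C C (id_adj C)"
proof -
  interpret I: cat_functor C C id_fctr by (rule id_cat_functor)
  interpret II: cat_functor C C "comp_fctr id_fctr id_fctr"
    by (rule comp_cat_functor[OF id_cat_functor id_cat_functor])
  have "nat_transformation C C id_fctr (comp_fctr id_fctr id_fctr) (Id C)"
    by unfold_locales (auto simp: Id_Hom Comp_Id Id_Comp)
  moreover have "nat_transformation C C (comp_fctr id_fctr id_fctr) id_fctr (Id C)"
    by unfold_locales (auto simp: Id_Hom Comp_Id Id_Comp)
  ultimately show ?thesis
    using I.cat_functor_axioms Comp_Id[OF Id_Hom]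
    by (simp add: adjunction_def id_adj_def)
qed

locale adjoint_pair = N: category N + M: category M
  for N :: "('o, 'm) cat" and M :: "('p, 'n) cat" +
  fixes A :: "('o, 'm, 'p, 'n) adj"
  assumes adjunction: "adjunction N M A"
begin

abbreviation compN (infixr "\<circ>\<^sub>N" 55) where "g \<circ>\<^sub>N f \<equiv> Comp N g f"
abbreviation compM (infixr "\<circ>\<^sub>M" 55) where "g \<circ>\<^sub>M f \<equiv> Comp M g f"
abbreviation Lo where "Lo \<equiv> on_ob (ladj A)"
abbreviation La where "La \<equiv> on_arr (ladj A)"
abbreviation Ro where "Ro \<equiv> on_ob (radj A)"
abbreviation Ra where "Ra \<equiv> on_arr (radj A)"
abbreviation \<eta> where "\<eta> \<equiv> aunit A"
abbreviation \<epsilon> where "\<epsilon> \<equiv> acounit A"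

sublocale L: cat_functor N M "ladj A"
  using adjunction by (simp add: adjunction_def)

sublocale R: cat_functor M N "radj A"
  using adjunction by (simp add: adjunction_def)

lemma unit_Hom: "X \<in> Ob N \<Longrightarrow> \<eta> X \<in> Hom N X (Ro (Lo X))"
  and unit_nat: "f \<in> Hom N X Y \<Longrightarrow> \<eta> Y \<circ>\<^sub>N f = Ra (La f) \<circ>\<^sub>N \<eta> X"
proof -
  interpret U: nat_transformation N N id_fctr "comp_fctr (radj A) (ladj A)" \<eta>
    using adjunction by (simp add: adjunction_def)
  show "X \<in> Ob N \<Longrightarrow> \<eta> X \<in> Hom N X (Ro (Lo X))"
    using U.component_Hom by simp
  show "f \<in> Hom N X Y \<Longrightarrow> \<eta> Y \<circ>\<^sub>N f = Ra (La f) \<circ>\<^sub>N \<eta> X"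
    using U.naturality by simp
qed

lemma counit_Hom: "Y \<in> Ob M \<Longrightarrow> \<epsilon> Y \<in> Hom M (Lo (Ro Y)) Y"
  and counit_nat: "f \<in> Hom M X Y \<Longrightarrow> \<epsilon> Y \<circ>\<^sub>M La (Ra f) = f \<circ>\<^sub>M \<epsilon> X"
proof -
  interpret U: nat_transformation M M "comp_fctr (ladj A) (radj A)" id_fctr \<epsilon>
    using adjunction by (simp add: adjunction_def)
  show "Y \<in> Ob M \<Longrightarrow> \<epsilon> Y \<in> Hom M (Lo (Ro Y)) Y"
    using U.component_Hom by simp
  show "f \<in> Hom M X Y \<Longrightarrow> \<epsilon> Y \<circ>\<^sub>M La (Ra f) = f \<circ>\<^sub>M \<epsilon> X"
    using U.naturality by simp
qed

lemma triangle_left: "X \<in> Ob N \<Longrightarrow> \<epsilon> (Lo X) \<circ>\<^sub>M La (\<eta> X) = Id M (Lo X)"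
  and triangle_right: "Y \<in> Ob M \<Longrightarrow> Ra (\<epsilon> Y) \<circ>\<^sub>N \<eta> (Ro Y) = Id N (Ro Y)"
  using adjunction by (simp_all add: adjunction_def)

lemmas homs = L.on_arr_Hom R.on_arr_Hom L.on_ob_Ob R.on_ob_Ob unit_Hom counit_Hom
  N.Comp_Hom M.Comp_Hom N.Id_Hom M.Id_Hom

end

lemma adjunction_comp_adj:
  assumes "adjunction N M A" "adjunction M P B" "category N" "category M" "category P"
  shows "adjunction N P (comp_adj N P B A)"
proof -
  interpret A: adjoint_pair N M A
    using assms by (simp add: adjoint_pair_def adjoint_pair_axioms_def)
  interpret B: adjoint_pair M P B
    using assms by (simp add: adjoint_pair_def adjoint_pair_axioms_def)
  let ?L = "comp_fctr (ladj B) (ladj A)" and ?R = "comp_fctr (radj A) (radj B)"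
  interpret L: cat_functor N P ?L
    by (rule comp_cat_functor) (fact A.L.cat_functor_axioms B.L.cat_functor_axioms)+
  interpret R: cat_functor P N ?R
    by (rule comp_cat_functor) (fact A.R.cat_functor_axioms B.R.cat_functor_axioms)+
  interpret RL: cat_functor N N "comp_fctr ?R ?L"
    by (rule comp_cat_functor) (fact L.cat_functor_axioms R.cat_functor_axioms)+
  interpret LR: cat_functor P P "comp_fctr ?L ?R"
    by (rule comp_cat_functor) (fact L.cat_functor_axioms R.cat_functor_axioms)+
  interpret I: cat_functor N N id_fctr by (rule A.N.id_cat_functor)
  interpret I': cat_functor P P id_fctr by (rule B.M.id_cat_functor)
  let ?u = "\<lambda>X. Comp N (A.Ra (B.\<eta> (A.Lo X))) (A.\<eta> X)"
  let ?c = "\<lambda>Z. Comp P (B.\<epsilon> Z) (B.La (A.\<epsilon> (B.Ro Z)))"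
  note h = A.homs B.homs
  have u_Hom: "?u X \<in> Hom N X (A.Ro (B.Ro (B.Lo (A.Lo X))))" if "X \<in> Ob N" for X
    using that by (blast intro: h)
  have c_Hom: "?c Z \<in> Hom P (B.Lo (A.Lo (A.Ro (B.Ro Z)))) Z" if "Z \<in> Ob P" for Z
    using that by (blast intro: h)
  have unit: "nat_transformation N N id_fctr (comp_fctr ?R ?L) ?u"
  proof (unfold_locales, goal_cases)
    case (1 X)
    then show ?case using u_Hom by simp
  next
    case (2 f X Y)
    note f = this
    have X: "X \<in> Ob N" and Y: "Y \<in> Ob N" using f A.N.Hom_Ob by auto
    let ?b = "\<lambda>X. A.Ra (B.\<eta> (A.Lo X))"
    have b: "?b X \<in> Hom N (A.Ro (A.Lo X)) (A.Ro (B.Ro (B.Lo (A.Lo X))))" if "X \<in> Ob N" for X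
      using that by (blast intro: h)
    have "Comp N (?u Y) f = Comp N (?b Y) (Comp N (A.\<eta> Y) f)"
      by (rule A.N.Comp_assoc[OF f A.unit_Hom[OF Y] b[OF Y]])
    also have "\<dots> = Comp N (?b Y) (Comp N (A.Ra (A.La f)) (A.\<eta> X))"
      by (simp add: A.unit_nat[OF f])
    also have "\<dots> = Comp N (Comp N (?b Y) (A.Ra (A.La f))) (A.\<eta> X)"
      by (rule A.N.Comp_assoc[symmetric, OF A.unit_Hom[OF X] _ b[OF Y]]) (blast intro: h f)
    also have "Comp N (?b Y) (A.Ra (A.La f)) = A.Ra (Comp M (B.\<eta> (A.Lo Y)) (A.La f))"
      by (rule A.R.on_arr_Comp[symmetric]) (use f Y in \<open>blast intro: h\<close>)+
    also have "\<dots> = A.Ra (Comp M (B.Ra (B.La (A.La f))) (B.\<eta> (A.Lo X)))"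
      using B.unit_nat[OF A.L.on_arr_Hom[OF f]] by simp
    also have "\<dots> = Comp N (A.Ra (B.Ra (B.La (A.La f)))) (?b X)"
      by (rule A.R.on_arr_Comp) (use f X in \<open>blast intro: h\<close>)+
    also have "Comp N \<dots> (A.\<eta> X) = Comp N (A.Ra (B.Ra (B.La (A.La f)))) (?u X)"
      by (rule A.N.Comp_assoc[OF A.unit_Hom[OF X] b[OF X]]) (blast intro: h f)
    finally show ?case by simp
  qed
  have counit: "nat_transformation P P (comp_fctr ?L ?R) id_fctr ?c"
  proof (unfold_locales, goal_cases)
    case (1 X)
    then show ?case using c_Hom by simp
  next
    case (2 f X Y)
    note f = this
    have X: "X \<in> Ob P" and Y: "Y \<in> Ob P" using f B.M.Hom_Ob by auto
    let ?b = "\<lambda>X. B.La (A.\<epsilon> (B.Ro X))"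
    have b: "?b X \<in> Hom P (B.Lo (A.Lo (A.Ro (B.Ro X)))) (B.Lo (B.Ro X))" if "X \<in> Ob P" for X
      using that by (blast intro: h)
    let ?f = "B.La (A.La (A.Ra (B.Ra f)))"
    have "Comp P (?c Y) ?f = Comp P (B.\<epsilon> Y) (Comp P (?b Y) ?f)"
      by (rule B.M.Comp_assoc[OF _ b[OF Y] B.counit_Hom[OF Y]]) (blast intro: h f)
    also have "Comp P (?b Y) ?f = B.La (Comp M (A.\<epsilon> (B.Ro Y)) (A.La (A.Ra (B.Ra f))))"
      by (rule B.L.on_arr_Comp[symmetric]) (use f Y in \<open>blast intro: h\<close>)+
    also have "\<dots> = B.La (Comp M (B.Ra f) (A.\<epsilon> (B.Ro X)))"
      using A.counit_nat[OF B.R.on_arr_Hom[OF f]] by simp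
    also have "\<dots> = Comp P (B.La (B.Ra f)) (?b X)"
      by (rule B.L.on_arr_Comp) (use f X in \<open>blast intro: h\<close>)+
    also have "Comp P (B.\<epsilon> Y) \<dots> = Comp P (Comp P (B.\<epsilon> Y) (B.La (B.Ra f))) (?b X)"
      by (rule B.M.Comp_assoc[symmetric, OF b[OF X] _ B.counit_Hom[OF Y]]) (blast intro: h f)
    also have "\<dots> = Comp P (Comp P f (B.\<epsilon> X)) (?b X)"
      by (simp add: B.counit_nat[OF f])
    also have "\<dots> = Comp P f (?c X)"
      by (rule B.M.Comp_assoc[OF b[OF X] B.counit_Hom[OF X] f])
    finally show ?case by simp
  qed
  \<comment> \<open>Naturality of the counit of \<open>A\<close> along the unit of \<open>B\<close>
    brings the unit and counit of \<open>A\<close> together; they cancel by the triangle identity of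
    \<open>A\<close>, and what remains is the triangle identity of \<open>B\<close>.\<close>
  have tri_left: "Comp P (?c (B.Lo (A.Lo X))) (B.La (A.La (?u X))) = Id P (B.Lo (A.Lo X))"
    if X: "X \<in> Ob N" for X
  proof -
    let ?Y = "A.Lo X"
    have Y: "?Y \<in> Ob M" using X by (blast intro: h)
    let ?e = "A.\<epsilon> (B.Ro (B.Lo ?Y))"
    have u: "B.\<eta> ?Y \<in> Hom M ?Y (B.Ro (B.Lo ?Y))" using Y by (blast intro: h)
    have e: "?e \<in> Hom M (A.Lo (A.Ro (B.Ro (B.Lo ?Y)))) (B.Ro (B.Lo ?Y))"
      using Y by (blast intro: h)
    have La_u: "A.La (?u X) \<in> Hom M ?Y (A.Lo (A.Ro (B.Ro (B.Lo ?Y))))"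
      using u_Hom[OF X] by (blast intro: h)
    have LR: "A.La (A.Ra (B.\<eta> ?Y)) \<in> Hom M (A.Lo (A.Ro ?Y)) (A.Lo (A.Ro (B.Ro (B.Lo ?Y))))"
      by (blast intro: h Y)
    have L\<eta>: "A.La (A.\<eta> X) \<in> Hom M ?Y (A.Lo (A.Ro ?Y))" using X by (blast intro: h)
    have "A.La (?u X) = Comp M (A.La (A.Ra (B.\<eta> ?Y))) (A.La (A.\<eta> X))"
      by (rule A.L.on_arr_Comp[OF A.unit_Hom[OF X] A.R.on_arr_Hom[OF u]])
    then have "Comp M ?e (A.La (?u X)) = Comp M (Comp M ?e (A.La (A.Ra (B.\<eta> ?Y)))) (A.La (A.\<eta> X))"
      using A.M.Comp_assoc[OF L\<eta> LR e] by simp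
    also have "\<dots> = Comp M (Comp M (B.\<eta> ?Y) (A.\<epsilon> ?Y)) (A.La (A.\<eta> X))"
      by (simp add: A.counit_nat[OF u])
    also have "\<dots> = Comp M (B.\<eta> ?Y) (Comp M (A.\<epsilon> ?Y) (A.La (A.\<eta> X)))"
      by (rule A.M.Comp_assoc[OF L\<eta> A.counit_Hom[OF Y] u])
    also have "\<dots> = B.\<eta> ?Y"
      by (simp add: A.triangle_left[OF X] A.M.Comp_Id[OF u])
    finally have *: "Comp M ?e (A.La (?u X)) = B.\<eta> ?Y" .
    have "Comp P (?c (B.Lo ?Y)) (B.La (A.La (?u X)))
        = Comp P (B.\<epsilon> (B.Lo ?Y)) (Comp P (B.La ?e) (B.La (A.La (?u X))))"
      by (rule B.M.Comp_assoc[OF B.L.on_arr_Hom[OF La_u] B.L.on_arr_Hom[OF e]]) (blast intro: h Y)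
    also have "\<dots> = Comp P (B.\<epsilon> (B.Lo ?Y)) (B.La (B.\<eta> ?Y))"
      using B.L.on_arr_Comp[OF La_u e] * by simp
    finally show ?thesis by (simp add: B.triangle_left[OF Y])
  qed
  \<comment> \<open>Here the unit and counit of \<open>B\<close> cancel first, through naturality of
    the unit of \<open>B\<close> along the counit of \<open>A\<close>; what remains is the triangle
    identity of \<open>A\<close>.\<close>
  have tri_right: "Comp N (A.Ra (B.Ra (?c Z))) (?u (A.Ro (B.Ro Z))) = Id N (A.Ro (B.Ro Z))"
    if Z: "Z \<in> Ob P" for Z
  proof -
    let ?Y = "B.Ro Z"
    let ?X = "A.Ro ?Y"
    have Y: "?Y \<in> Ob M" using Z by (blast intro: h)
    let ?v = "B.\<eta> (A.Lo ?X)"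
    have e: "A.\<epsilon> ?Y \<in> Hom M (A.Lo ?X) ?Y" by (blast intro: h Y)
    have c: "B.Ra (?c Z) \<in> Hom M (B.Ro (B.Lo (A.Lo ?X))) ?Y"
      using c_Hom[OF Z] by (blast intro: h)
    have v: "?v \<in> Hom M (A.Lo ?X) (B.Ro (B.Lo (A.Lo ?X)))" using Z by (blast intro: h)
    have RL: "B.Ra (B.La (A.\<epsilon> ?Y)) \<in> Hom M (B.Ro (B.Lo (A.Lo ?X))) (B.Ro (B.Lo ?Y))"
      by (blast intro: h Y)
    have R\<epsilon>: "B.Ra (B.\<epsilon> Z) \<in> Hom M (B.Ro (B.Lo ?Y)) ?Y" using Z by (blast intro: h)
    have "B.Ra (?c Z) = Comp M (B.Ra (B.\<epsilon> Z)) (B.Ra (B.La (A.\<epsilon> ?Y)))"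
      by (rule B.R.on_arr_Comp[OF B.L.on_arr_Hom[OF e] B.counit_Hom[OF Z]])
    then have "Comp M (B.Ra (?c Z)) ?v = Comp M (B.Ra (B.\<epsilon> Z)) (Comp M (B.Ra (B.La (A.\<epsilon> ?Y))) ?v)"
      using A.M.Comp_assoc[OF v RL R\<epsilon>] by simp
    also have "\<dots> = Comp M (B.Ra (B.\<epsilon> Z)) (Comp M (B.\<eta> ?Y) (A.\<epsilon> ?Y))"
      by (simp add: B.unit_nat[OF e])
    also have "\<dots> = Comp M (Comp M (B.Ra (B.\<epsilon> Z)) (B.\<eta> ?Y)) (A.\<epsilon> ?Y)"
      by (rule A.M.Comp_assoc[symmetric, OF e B.unit_Hom[OF Y] R\<epsilon>])
    also have "\<dots> = A.\<epsilon> ?Y"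
      by (simp add: B.triangle_right[OF Z] A.M.Id_Comp[OF e])
    finally have *: "Comp M (B.Ra (?c Z)) ?v = A.\<epsilon> ?Y" .
    have "Comp N (A.Ra (B.Ra (?c Z))) (?u ?X)
        = Comp N (Comp N (A.Ra (B.Ra (?c Z))) (A.Ra ?v)) (A.\<eta> ?X)"
      by (rule A.N.Comp_assoc[symmetric, OF _ A.R.on_arr_Hom[OF v] A.R.on_arr_Hom[OF c]]) (blast intro: h Y)
    also have "\<dots> = Comp N (A.Ra (A.\<epsilon> ?Y)) (A.\<eta> ?X)"
      using A.R.on_arr_Comp[OF v c] * by simp
    finally show ?thesis by (simp add: A.triangle_right[OF Y])
  qed
  show ?thesis
    using L.cat_functor_axioms R.cat_functor_axioms unit counit tri_left tri_right
    by (simp add: adjunction_def comp_adj_def)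
qed

subsection \<open>Comonadicity from preservation and reflection\<close>

text \<open>A property of the arrow \<open>e\<close>, not a choice of limit: several arrows may be
  equalizers of the same pair, and the comonadicity argument compares two of them.\<close>

definition equalizer :: "('o, 'm) cat \<Rightarrow> 'm \<Rightarrow> 'm \<Rightarrow> 'm \<Rightarrow> bool" where
  "equalizer C e f g \<longleftrightarrow>
     (\<exists>E X Y. e \<in> Hom C E X \<and> f \<in> Hom C X Y \<and> g \<in> Hom C X Y \<and>
        Comp C f e = Comp C g e \<and>
        (\<forall>W. \<forall>h \<in> Hom C W X. Comp C f h = Comp C g h \<longrightarrow> (\<exists>!u. u \<in> Hom C W E \<and> Comp C e u = h)))"

lemma equalizerI:
  assumes "e \<in> Hom C E X" "f \<in> Hom C X Y" "g \<in> Hom C X Y" "Comp C f e = Comp C g e"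
    and "\<And>W h. h \<in> Hom C W X \<Longrightarrow> Comp C f h = Comp C g h \<Longrightarrow> \<exists>u. u \<in> Hom C W E \<and> Comp C e u = h"
    and "\<And>W u v. u \<in> Hom C W E \<Longrightarrow> v \<in> Hom C W E \<Longrightarrow> Comp C e u = Comp C e v \<Longrightarrow> u = v"
  shows "equalizer C e f g"
proof -
  have "\<forall>W. \<forall>h \<in> Hom C W X. Comp C f h = Comp C g h \<longrightarrow> (\<exists>!u. u \<in> Hom C W E \<and> Comp C e u = h)"
    by (intro allI ballI impI ex_ex1I) (use assms(5,6) in \<open>blast+\<close>)
  then show ?thesis using assms(1-4) unfolding equalizer_def by blast
qed

lemma equalizer_eq:
  assumes "equalizer C e f g"
  shows "Comp C f e = Comp C g e"
  using assms by (auto simp: equalizer_def)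

lemma equalizer_ex1:
  assumes "equalizer C e f g" "e \<in> Hom C E X" "h \<in> Hom C W X" "Comp C f h = Comp C g h"
  shows "\<exists>!u. u \<in> Hom C W E \<and> Comp C e u = h"
proof -
  obtain E' X' where e: "e \<in> Hom C E' X'"
    and *: "\<forall>W. \<forall>h \<in> Hom C W X'. Comp C f h = Comp C g h \<longrightarrow>
      (\<exists>!u. u \<in> Hom C W E' \<and> Comp C e u = h)"
    using assms(1) unfolding equalizer_def by blast
  have "E' = E" "X' = X" using e assms(2) HomD by metis+
  then show ?thesis using * assms(3,4) by blast
qed

lemma (in category) equalizer_mono:
  assumes e: "equalizer C e f g" "e \<in> Hom C E X" and u: "u \<in> Hom C W E" "v \<in> Hom C W E"
    and eq: "Comp C e u = Comp C e v"
  shows "u = v"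
proof -
  obtain Y where f: "f \<in> Hom C X Y" "g \<in> Hom C X Y"
    using e HomD unfolding equalizer_def by metis
  have h: "Comp C e v \<in> Hom C W X" using Comp_Hom[OF u(2) e(2)] .
  have "Comp C f (Comp C e v) = Comp C g (Comp C e v)"
    using Comp_assoc[OF u(2) e(2) f(1)] Comp_assoc[OF u(2) e(2) f(2)] equalizer_eq[OF e(1)] by simp
  from equalizer_ex1[OF e h this] show ?thesis using u eq by blast
qed

text \<open>The definite description in \<open>lift_mono\<close> is meaningful only for a unique
  factorization, which the universal property supplies.\<close>

lemma lift_mono:
  assumes "equalizer C e f g" "e \<in> Hom C E X" "h \<in> Hom C W X" "Comp C f h = Comp C g h"
  shows "lift_mono C e h \<in> Hom C W E" "Comp C e (lift_mono C e h) = h"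
  using theI'[OF equalizer_ex1[OF assms]] HomD[OF assms(2)] HomD[OF assms(3)]
  by (simp_all add: lift_mono_def)

text \<open>The inverse is the factorization of \<open>e'\<close> through \<open>e\<close>; both
  composites become identities after cancelling an equalizer arrow. The comparison unit and counit
  are both proved invertible by this.\<close>

lemma (in category) is_iso_between_equalizers:
  assumes e: "equalizer C e f g" "e \<in> Hom C E X" and e': "equalizer C e' f g" "e' \<in> Hom C E' X"
    and u: "u \<in> Hom C E E'" and eu: "Comp C e' u = e"
  shows "is_iso C u"
proof -
  obtain v where v: "v \<in> Hom C E' E" and ev: "Comp C e v = e'"
    using equalizer_ex1[OF e e'(2) equalizer_eq[OF e'(1)]] by blast
  have E: "E \<in> Ob C" "E' \<in> Ob C" using Hom_Ob[OF u] by auto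
  have "Comp C e (Comp C v u) = Comp C e (Id C E)"
    using Comp_assoc[OF u v e(2)] ev eu Comp_Id[OF e(2)] by simp
  moreover have "Comp C e' (Comp C u v) = Comp C e' (Id C E')"
    using Comp_assoc[OF v u e'(2)] ev eu Comp_Id[OF e'(2)] by simp
  ultimately show ?thesis
    using equalizer_mono[OF e Comp_Hom[OF u v] Id_Hom[OF E(1)]]
      equalizer_mono[OF e' Comp_Hom[OF v u] Id_Hom[OF E(2)]] u v by (blast intro: is_isoI)
qed

section \<open>Coalgebras and the comparison functor\<close>

context adjoint_pair
begin

abbreviation K where "K \<equiv> comonad_of A"
abbreviation coA where "coA \<equiv> coAlg M K"

lemma coalgebra_iff:
  "coalgebra M K B \<longleftrightarrow>
     fst B \<in> Ob M \<and> snd B \<in> Hom M (fst B) (Lo (Ro (fst B))) \<and>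
     La (Ra (snd B)) \<circ>\<^sub>M snd B = La (\<eta> (Ro (fst B))) \<circ>\<^sub>M snd B \<and>
     \<epsilon> (fst B) \<circ>\<^sub>M snd B = Id M (fst B)"
  by (cases B) (simp add: coalgebra_def comonad_of_def)

lemma coalgebraD:
  assumes "coalgebra M K B"
  shows "fst B \<in> Ob M" "snd B \<in> Hom M (fst B) (Lo (Ro (fst B)))"
    "La (Ra (snd B)) \<circ>\<^sub>M snd B = La (\<eta> (Ro (fst B))) \<circ>\<^sub>M snd B"
    "\<epsilon> (fst B) \<circ>\<^sub>M snd B = Id M (fst B)"
  using assms by (simp_all add: coalgebra_iff)

lemma Hom_coAlg_iff:
  "\<phi> \<in> Hom coA B B' \<longleftrightarrow>
     coalgebra M K B \<and> coalgebra M K B' \<and> (\<exists>f. \<phi> = (B, f, B') \<and> f \<in> Hom M (fst B) (fst B') \<and>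
       snd B' \<circ>\<^sub>M f = La (Ra f) \<circ>\<^sub>M snd B)"
  unfolding Hom_def[of coA]
  by (cases B; cases B') (auto simp: coAlg_def coalgebra_mor_def comonad_of_def)

lemma coAlg_simps [simp]:
  "Ob coA = {B. coalgebra M K B}"
  "Id coA B = (B, Id M (fst B), B)"
  "Comp coA (B', g, D) (B, f, B'') = (B, g \<circ>\<^sub>M f, D)"
  by (simp_all add: coAlg_def)

lemma coalgebra_mor_comp:
  assumes B: "coalgebra M K B" and f: "f \<in> Hom M (fst B) (fst B')" "snd B' \<circ>\<^sub>M f = La (Ra f) \<circ>\<^sub>M snd B"
    and B': "coalgebra M K B'" and g: "g \<in> Hom M (fst B') (fst B'')" "snd B'' \<circ>\<^sub>M g = La (Ra g) \<circ>\<^sub>M snd B'"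
    and B'': "coalgebra M K B''"
  shows "snd B'' \<circ>\<^sub>M g \<circ>\<^sub>M f = La (Ra (g \<circ>\<^sub>M f)) \<circ>\<^sub>M snd B"
proof -
  note d = coalgebraD(2)[OF B] coalgebraD(2)[OF B'] coalgebraD(2)[OF B'']
  note F = L.on_arr_Hom[OF R.on_arr_Hom[OF f(1)]] and G = L.on_arr_Hom[OF R.on_arr_Hom[OF g(1)]]
  have "snd B'' \<circ>\<^sub>M g \<circ>\<^sub>M f = (snd B'' \<circ>\<^sub>M g) \<circ>\<^sub>M f"
    by (rule M.Comp_assoc[symmetric, OF f(1) g(1) d(3)])
  also have "\<dots> = La (Ra g) \<circ>\<^sub>M snd B' \<circ>\<^sub>M f"
    by (simp add: g(2) M.Comp_assoc[OF f(1) d(2) G])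
  also have "\<dots> = (La (Ra g) \<circ>\<^sub>M La (Ra f)) \<circ>\<^sub>M snd B"
    by (simp add: f(2) M.Comp_assoc[OF d(1) F G])
  also have "La (Ra g) \<circ>\<^sub>M La (Ra f) = La (Ra (g \<circ>\<^sub>M f))"
    by (simp add: R.on_arr_Comp[OF f(1) g(1)]
        L.on_arr_Comp[OF R.on_arr_Hom[OF f(1)] R.on_arr_Hom[OF g(1)]])
  finally show ?thesis .
qed

lemma category_coAlg: "category coA"
proof (unfold_locales, goal_cases)
  case (1 f)
  then show ?case by (auto simp: coAlg_def)
next
  case (2 f)
  then show ?case by (auto simp: coAlg_def)
next
  case (3 B)
  then have B: "coalgebra M K B" by simp
  note d = coalgebraD[OF B]
  have "La (Ra (Id M (fst B))) = Id M (Lo (Ro (fst B)))"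
    using d(1) by (simp add: R.on_arr_Id L.on_arr_Id R.on_ob_Ob)
  then show ?case
    using B M.Id_Hom[OF d(1)] M.Comp_Id[OF d(2)] M.Id_Comp[OF d(2)] by (auto simp: Hom_coAlg_iff)
next
  case (4 f X Y g Z)
  then show ?case
    by (auto simp: Hom_coAlg_iff intro!: M.Comp_Hom coalgebra_mor_comp[of X _ Y _ Z])
next
  case (5 f X Y)
  then show ?case using M.Comp_Id by (auto simp: Hom_coAlg_iff)
next
  case (6 f X Y)
  then show ?case using M.Id_Comp by (auto simp: Hom_coAlg_iff)
next
  case (7 f W X g Y h Z)
  then show ?case using M.Comp_assoc by (auto simp: Hom_coAlg_iff)
qed

text \<open>The inverse \<open>g\<close> of the underlying arrow is automatically compatible with
  the coactions: LR turns \<open>g\<close> into an inverse of LR applied to \<open>f\<close>, so the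
  square of \<open>f\<close> can be read backwards.\<close>

lemma is_iso_coAlg:
  assumes f: "(B, f, B') \<in> Hom coA B B'" and iso: "is_iso M f"
  shows "is_iso coA (B, f, B')"
proof -
  have B: "coalgebra M K B" and B': "coalgebra M K B'"
    and fH: "f \<in> Hom M (fst B) (fst B')" and fc: "snd B' \<circ>\<^sub>M f = La (Ra f) \<circ>\<^sub>M snd B"
    using f by (auto simp: Hom_coAlg_iff)
  obtain g where g: "g \<in> Hom M (fst B') (fst B)"
    and gf: "g \<circ>\<^sub>M f = Id M (fst B)" and fg: "f \<circ>\<^sub>M g = Id M (fst B')"
    using is_isoE[OF iso fH] .
  note d = coalgebraD(2)[OF B] and d' = coalgebraD(2)[OF B']
  note F = L.on_arr_Hom[OF R.on_arr_Hom[OF fH]] and G = L.on_arr_Hom[OF R.on_arr_Hom[OF g]]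
  have GF: "La (Ra g) \<circ>\<^sub>M La (Ra f) = Id M (Lo (Ro (fst B)))"
    using gf coalgebraD(1)[OF B]
    by (simp add: R.on_arr_Comp[OF fH g, symmetric] R.on_arr_Id L.on_arr_Id R.on_ob_Ob
        L.on_arr_Comp[OF R.on_arr_Hom[OF fH] R.on_arr_Hom[OF g], symmetric])
  have "snd B \<circ>\<^sub>M g = (La (Ra g) \<circ>\<^sub>M La (Ra f)) \<circ>\<^sub>M snd B \<circ>\<^sub>M g"
    using M.Id_Comp[OF M.Comp_Hom[OF g d]] GF by simp
  also have "\<dots> = La (Ra g) \<circ>\<^sub>M La (Ra f) \<circ>\<^sub>M snd B \<circ>\<^sub>M g"
    by (rule M.Comp_assoc[OF M.Comp_Hom[OF g d] F G])
  also have "La (Ra f) \<circ>\<^sub>M snd B \<circ>\<^sub>M g = (snd B' \<circ>\<^sub>M f) \<circ>\<^sub>M g"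
    by (simp add: fc M.Comp_assoc[OF g d F])
  also have "\<dots> = snd B'"
    by (simp add: M.Comp_assoc[OF g fH d'] fg M.Comp_Id[OF d'])
  finally have gc: "(B', g, B) \<in> Hom coA B' B"
    using B B' g by (simp add: Hom_coAlg_iff)
  show ?thesis
    by (rule is_isoI[OF f gc]) (simp_all add: gf fg)
qed

text \<open>The splitting is given by \<open>\<epsilon>\<^sub>Y\<close> and \<open>\<epsilon>\<^bsub>LRY\<^esub>\<close>.\<close>

lemma equalizer_coaction:
  assumes "coalgebra M K B"
  shows "equalizer M (snd B) (La (Ra (snd B))) (La (\<eta> (Ro (fst B))))"
proof -
  obtain Y \<delta> where [simp]: "B = (Y, \<delta>)" by force
  note B = coalgebraD[OF assms, simplified]
  let ?LR = "Lo (Ro Y)"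
  note L\<delta> = L.on_arr_Hom[OF R.on_arr_Hom[OF B(2)]]
  note e = counit_Hom[OF B(1)] and e' = counit_Hom[OF L.on_ob_Ob[OF R.on_ob_Ob[OF B(1)]]]
  note L\<eta> = L.on_arr_Hom[OF unit_Hom[OF R.on_ob_Ob[OF B(1)]]]
  show ?thesis
    unfolding \<open>B = (Y, \<delta>)\<close> fst_conv snd_conv
  proof (rule equalizerI[OF B(2) L\<delta> L\<eta> B(3)])
    fix W h assume h: "h \<in> Hom M W ?LR" and eq: "La (Ra \<delta>) \<circ>\<^sub>M h = La (\<eta> (Ro Y)) \<circ>\<^sub>M h"
    have "\<delta> \<circ>\<^sub>M \<epsilon> Y \<circ>\<^sub>M h = (\<delta> \<circ>\<^sub>M \<epsilon> Y) \<circ>\<^sub>M h"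
      by (rule M.Comp_assoc[symmetric, OF h e B(2)])
    also have "\<dots> = \<epsilon> ?LR \<circ>\<^sub>M La (Ra \<delta>) \<circ>\<^sub>M h"
      by (simp add: counit_nat[OF B(2), symmetric] M.Comp_assoc[OF h L\<delta> e'])
    also have "\<dots> = h"
      using R.on_ob_Ob[OF B(1)]
      by (simp add: eq M.Comp_assoc[OF h L\<eta> e', symmetric] triangle_left M.Id_Comp[OF h])
    finally show "\<exists>u. u \<in> Hom M W Y \<and> \<delta> \<circ>\<^sub>M u = h"
      using M.Comp_Hom[OF h e] by blast
  next
    fix W u v assume u: "u \<in> Hom M W Y" "v \<in> Hom M W Y" "\<delta> \<circ>\<^sub>M u = \<delta> \<circ>\<^sub>M v"
    then show "u = v"
      using M.Comp_assoc[OF u(1) B(2) e] M.Comp_assoc[OF u(2) B(2) e] B(4)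
      by (simp add: M.Id_Comp[OF u(1)] M.Id_Comp[OF u(2)])
  qed
qed

abbreviation "can \<equiv> Can N A"

lemma Can_simps [simp]:
  "on_ob can X = (Lo X, La (\<eta> X))"
  "f \<in> Hom N X Y \<Longrightarrow> on_arr can f = ((Lo X, La (\<eta> X)), La f, (Lo Y, La (\<eta> Y)))"
  by (auto simp: Can_def Let_def HomD)

text \<open>Coassociativity is L applied to the naturality square of \<eta> along its own component
  at \<open>X\<close>; the counit law is a triangle identity.\<close>

lemma coalgebra_Can:
  assumes X: "X \<in> Ob N"
  shows "coalgebra M K (Lo X, La (\<eta> X))"
proof -
  note u = unit_Hom[OF X]
  note LX = L.on_ob_Ob[OF X]
  have "La (Ra (La (\<eta> X))) \<circ>\<^sub>M La (\<eta> X) = La (\<eta> (Ro (Lo X))) \<circ>\<^sub>M La (\<eta> X)"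
    by (simp add: unit_nat[OF u] L.on_arr_Comp[symmetric, OF u R.on_arr_Hom[OF L.on_arr_Hom[OF u]]]
        L.on_arr_Comp[symmetric, OF u unit_Hom[OF R.on_ob_Ob[OF LX]]])
  then show ?thesis
    using X LX by (simp add: coalgebra_iff triangle_left L.on_arr_Hom[OF u])
qed

lemma cat_functor_Can: "cat_functor N coA can"
proof -
  interpret Q: category coA by (rule category_coAlg)
  show ?thesis
  proof (unfold_locales, goal_cases)
    case (1 X)
    then show ?case by (simp add: coalgebra_Can)
  next
    case (2 f X Y)
    note XY = N.Hom_Ob[OF 2]
    have "La (\<eta> Y) \<circ>\<^sub>M La f = La (Ra (La f)) \<circ>\<^sub>M La (\<eta> X)"
      using L.on_arr_Comp[OF 2 unit_Hom[OF XY(2)]]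
        L.on_arr_Comp[OF unit_Hom[OF XY(1)] R.on_arr_Hom[OF L.on_arr_Hom[OF 2]]] unit_nat[OF 2]
      by simp
    then show ?case
      using 2 XY by (simp add: Hom_coAlg_iff coalgebra_Can L.on_arr_Hom)
  next
    case (3 X)
    then show ?case using N.Id_Hom[OF 3] by (simp add: L.on_arr_Id)
  next
    case (4 f X Y g Z)
    then show ?case using N.Comp_Hom[OF 4] by (simp add: L.on_arr_Comp)
  qed
qed

end

text \<open>The dual of Beck's crude monadicity theorem. The chosen equalizers are a parameter
  because \<open>V\<close> is built from a choice, and preservation is phrased for this
  choice.\<close>

locale comonadicity_criterion = adjoint_pair N M A
  for N :: "('o, 'm) cat" and M :: "('p, 'n) cat" and A :: "('o, 'm, 'p, 'n) adj" +
  fixes eqz :: "'m \<Rightarrow> 'm \<Rightarrow> 'm"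
  assumes equalizer_eqz: "f \<in> Hom N X Y \<Longrightarrow> g \<in> Hom N X Y \<Longrightarrow> equalizer N (eqz f g) f g"
    and preserves_eqz: "f \<in> Hom N X Y \<Longrightarrow> g \<in> Hom N X Y \<Longrightarrow>
      equalizer M (La (eqz f g)) (La f) (La g)"
    and reflects_iso: "f \<in> Arr N \<Longrightarrow> is_iso M (La f) \<Longrightarrow> is_iso N f"
begin

abbreviation incl where "incl \<equiv> V_incl A eqz"
abbreviation VV where "VV \<equiv> V N A eqz"
abbreviation cadj where "cadj \<equiv> comparison_adj N M A eqz"

lemma equalizer_incl:
  assumes B: "coalgebra M K B"
  shows "equalizer N (incl B) (Ra (snd B)) (\<eta> (Ro (fst B)))"
    and "equalizer M (La (incl B)) (La (Ra (snd B))) (La (\<eta> (Ro (fst B))))"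
    and "incl B \<in> Hom N (on_ob VV B) (Ro (fst B))"
proof -
  note d = coalgebraD[OF B]
  have i: "incl B = eqz (Ra (snd B)) (\<eta> (Ro (fst B)))" by (cases B) (simp add: V_incl_def)
  note fg = R.on_arr_Hom[OF d(2)] unit_Hom[OF R.on_ob_Ob[OF d(1)]]
  show e: "equalizer N (incl B) (Ra (snd B)) (\<eta> (Ro (fst B)))"
    unfolding i by (rule equalizer_eqz[OF fg])
  show "equalizer M (La (incl B)) (La (Ra (snd B))) (La (\<eta> (Ro (fst B))))"
    unfolding i by (rule preserves_eqz[OF fg])
  obtain E X Z where "incl B \<in> Hom N E X" "Ra (snd B) \<in> Hom N X Z"
    using e unfolding equalizer_def by blast
  then show "incl B \<in> Hom N (on_ob VV B) (Ro (fst B))"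
    using HomD[OF fg(1)] by (auto simp: V_def Hom_def)
qed

lemma incl_mono:
  assumes "coalgebra M K B" "u \<in> Hom N W (on_ob VV B)" "v \<in> Hom N W (on_ob VV B)"
    "incl B \<circ>\<^sub>N u = incl B \<circ>\<^sub>N v"
  shows "u = v"
  using N.equalizer_mono[OF equalizer_incl(1,3)[OF assms(1)] assms(2-)] .

text \<open>The arrow \<open>f\<close>, transported by R and restricted to the equalizer of
  \<open>B\<close>, equalizes the pair of \<open>B'\<close>: the coalgebra square of
  \<open>f\<close> moves it past the coactions, naturality of \<eta> past the units. Hence the
  definite description in \<open>V\<close> is defined on every coalgebra morphism.\<close>

lemma V_arr:
  assumes f: "(B, f, B') \<in> Hom coA B B'"
  shows "on_arr VV (B, f, B') \<in> Hom N (on_ob VV B) (on_ob VV B')"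
    and "incl B' \<circ>\<^sub>N on_arr VV (B, f, B') = Ra f \<circ>\<^sub>N incl B"
proof -
  have B: "coalgebra M K B" and B': "coalgebra M K B'"
    and f: "f \<in> Hom M (fst B) (fst B')" and fc: "snd B' \<circ>\<^sub>M f = La (Ra f) \<circ>\<^sub>M snd B"
    using f by (auto simp: Hom_coAlg_iff)
  note d = coalgebraD[OF B] and d' = coalgebraD[OF B'] and i = equalizer_incl[OF B]
    and i' = equalizer_incl[OF B']
  note LRf = L.on_arr_Hom[OF R.on_arr_Hom[OF f]]
  note Rf = R.on_arr_Hom[OF f] and Rd = R.on_arr_Hom[OF d(2)] and Rd' = R.on_arr_Hom[OF d'(2)]
  note u = unit_Hom[OF R.on_ob_Ob[OF d(1)]] and u' = unit_Hom[OF R.on_ob_Ob[OF d'(1)]]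
  note RLRf = R.on_arr_Hom[OF LRf]
  have "Ra (snd B') \<circ>\<^sub>N Ra f \<circ>\<^sub>N incl B = Ra (snd B' \<circ>\<^sub>M f) \<circ>\<^sub>N incl B"
    by (simp add: R.on_arr_Comp[OF f d'(2)] N.Comp_assoc[OF i(3) Rf Rd'])
  also have "\<dots> = Ra (La (Ra f)) \<circ>\<^sub>N Ra (snd B) \<circ>\<^sub>N incl B"
    by (simp add: fc R.on_arr_Comp[OF d(2) LRf] N.Comp_assoc[OF i(3) Rd RLRf])
  also have "\<dots> = (Ra (La (Ra f)) \<circ>\<^sub>N \<eta> (Ro (fst B))) \<circ>\<^sub>N incl B"
    by (simp add: equalizer_eq[OF i(1)] N.Comp_assoc[OF i(3) u RLRf])
  also have "\<dots> = \<eta> (Ro (fst B')) \<circ>\<^sub>N Ra f \<circ>\<^sub>N incl B"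
    by (simp add: unit_nat[OF Rf, symmetric] N.Comp_assoc[OF i(3) Rf u'])
  finally have "Ra (snd B') \<circ>\<^sub>N Ra f \<circ>\<^sub>N incl B = \<eta> (Ro (fst B')) \<circ>\<^sub>N Ra f \<circ>\<^sub>N incl B" .
  note l = lift_mono[OF i'(1,3) N.Comp_Hom[OF i(3) Rf] this]
  then show "on_arr VV (B, f, B') \<in> Hom N (on_ob VV B) (on_ob VV B')"
    "incl B' \<circ>\<^sub>N on_arr VV (B, f, B') = Ra f \<circ>\<^sub>N incl B"
    by (simp_all add: V_def)
qed

text \<open>The functor laws hold after composing with the equalizer inclusion, where the action of
  \<open>V\<close> becomes that of R; the inclusion is then cancelled.\<close>

lemma cat_functor_V: "cat_functor coA N VV"
proof -
  interpret Q: category coA by (rule category_coAlg)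
  show ?thesis
  proof (unfold_locales, goal_cases)
    case (1 B)
    then show ?case using equalizer_incl(3)[THEN N.Hom_Ob(1)] by simp
  next
    case (2 f X Y)
    then obtain f' where [simp]: "f = (X, f', Y)" by (auto simp: Hom_coAlg_iff)
    show ?case using 2 V_arr(1) by simp
  next
    case (3 B)
    then have B: "coalgebra M K B" by simp
    note V = V_arr[OF Q.Id_Hom[OF 3, simplified]] and i = equalizer_incl(3)[OF B]
    have "on_ob VV B \<in> Ob N" using i N.Hom_Ob by blast
    moreover have "Ra (Id M (fst B)) = Id N (Ro (fst B))"
      using coalgebraD(1)[OF B] by (simp add: R.on_arr_Id)
    ultimately show ?case
      using incl_mono[OF B V(1) N.Id_Hom] V(2) N.Id_Comp[OF i] N.Comp_Id[OF i] by simp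
  next
    case (4 f B B' g B'')
    from 4 obtain f' g' where [simp]: "f = (B, f', B')" "g = (B', g', B'')"
      by (auto simp: Hom_coAlg_iff)
    have B: "coalgebra M K B" and B': "coalgebra M K B'" and B'': "coalgebra M K B''"
      and f: "f' \<in> Hom M (fst B) (fst B')" and g: "g' \<in> Hom M (fst B') (fst B'')"
      using 4 by (auto simp: Hom_coAlg_iff)
    note Vf = V_arr[OF 4(1)[simplified]] and Vg = V_arr[OF 4(2)[simplified]]
      and Vgf = V_arr[OF Q.Comp_Hom[OF 4, simplified]]
    note i = equalizer_incl(3)[OF B] and i' = equalizer_incl(3)[OF B'] and i'' = equalizer_incl(3)[OF B'']
    have "incl B'' \<circ>\<^sub>N on_arr VV g \<circ>\<^sub>N on_arr VV f = Ra g' \<circ>\<^sub>N incl B' \<circ>\<^sub>N on_arr VV f"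
      using N.Comp_assoc[OF Vf(1) Vg(1) i''] N.Comp_assoc[OF Vf(1) i' R.on_arr_Hom[OF g]] Vg(2)
      by simp
    also have "\<dots> = Ra (g' \<circ>\<^sub>M f') \<circ>\<^sub>N incl B"
      using Vf(2) by (simp add: R.on_arr_Comp[OF f g]
          N.Comp_assoc[OF i R.on_arr_Hom[OF f] R.on_arr_Hom[OF g]])
    finally show ?case
      using incl_mono[OF B'' Vgf(1) N.Comp_Hom[OF Vf(1) Vg(1)]] Vgf(2) by simp
  qed
qed

lemma cadj_simps [simp]:
  "ladj cadj = can" "radj cadj = VV"
  "aunit cadj X = lift_mono N (incl (Lo X, La (\<eta> X))) (\<eta> X)"
  "acounit cadj B = ((Lo (on_ob VV B), La (\<eta> (on_ob VV B))), \<epsilon> (fst B) \<circ>\<^sub>M La (incl B), B)"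
  by (simp_all add: comparison_adj_def)

text \<open>The unit \<eta> at \<open>X\<close> equalizes the pair of the coalgebra on LX by
  naturality of \<eta> along itself, so it factors through \<open>incl\<close>.\<close>

lemma comparison_unit:
  assumes X: "X \<in> Ob N"
  shows "aunit cadj X \<in> Hom N X (on_ob VV (Lo X, La (\<eta> X)))"
    and "incl (Lo X, La (\<eta> X)) \<circ>\<^sub>N aunit cadj X = \<eta> X"
proof -
  note i = equalizer_incl[OF coalgebra_Can[OF X]]
  have "Ra (La (\<eta> X)) \<circ>\<^sub>N \<eta> X = \<eta> (Ro (Lo X)) \<circ>\<^sub>N \<eta> X"
    by (simp add: unit_nat[OF unit_Hom[OF X]])
  with lift_mono[OF i(1,3)] unit_Hom[OF X]
  show "aunit cadj X \<in> Hom N X (on_ob VV (Lo X, La (\<eta> X)))"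
    "incl (Lo X, La (\<eta> X)) \<circ>\<^sub>N aunit cadj X = \<eta> X"
    by simp_all
qed

text \<open>The second fact exhibits \<open>c\<close> as an arrow between two equalizers of one
  pair, which makes it invertible later. The third says that \<open>c\<close> is the adjunct of the
  inclusion; it yields both the coalgebra square and a triangle identity of the comparison
  adjunction.\<close>

lemma comparison_counit:
  assumes B: "coalgebra M K B"
  defines "c \<equiv> \<epsilon> (fst B) \<circ>\<^sub>M La (incl B)"
  shows "c \<in> Hom M (Lo (on_ob VV B)) (fst B)"
    and "snd B \<circ>\<^sub>M c = La (incl B)"
    and "Ra c \<circ>\<^sub>N \<eta> (on_ob VV B) = incl B"
    and "acounit cadj B \<in> Hom coA (on_ob can (on_ob VV B)) B"
proof -
  note d = coalgebraD[OF B] and i = equalizer_incl[OF B]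
  let ?Y = "fst B" and ?E = "on_ob VV B"
  have E: "?E \<in> Ob N" and RY: "Ro ?Y \<in> Ob N" using i(3) N.Hom_Ob by blast+
  note e = counit_Hom[OF d(1)] and e' = counit_Hom[OF L.on_ob_Ob[OF RY]]
  note Li = L.on_arr_Hom[OF i(3)] and Rd = R.on_arr_Hom[OF d(2)] and u = unit_Hom[OF RY]
  show c: "c \<in> Hom M (Lo ?E) ?Y"
    unfolding c_def by (rule M.Comp_Hom[OF Li e])
  have "snd B \<circ>\<^sub>M c = (snd B \<circ>\<^sub>M \<epsilon> ?Y) \<circ>\<^sub>M La (incl B)"
    unfolding c_def by (rule M.Comp_assoc[symmetric, OF Li e d(2)])
  also have "\<dots> = \<epsilon> (Lo (Ro ?Y)) \<circ>\<^sub>M La (Ra (snd B)) \<circ>\<^sub>M La (incl B)"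
    by (simp add: counit_nat[OF d(2), symmetric] M.Comp_assoc[OF Li L.on_arr_Hom[OF Rd] e'])
  also have "\<dots> = (\<epsilon> (Lo (Ro ?Y)) \<circ>\<^sub>M La (\<eta> (Ro ?Y))) \<circ>\<^sub>M La (incl B)"
    by (simp add: equalizer_eq[OF i(2)] M.Comp_assoc[OF Li L.on_arr_Hom[OF u] e'])
  also have "\<dots> = La (incl B)"
    by (simp add: triangle_left[OF RY] M.Id_Comp[OF Li])
  finally show dc: "snd B \<circ>\<^sub>M c = La (incl B)" .
  have RLi: "Ra (La (incl B)) \<in> Hom N (Ro (Lo ?E)) (Ro (Lo (Ro ?Y)))"
    by (rule R.on_arr_Hom[OF Li])
  have "Ra c \<circ>\<^sub>N \<eta> ?E = Ra (\<epsilon> ?Y) \<circ>\<^sub>N Ra (La (incl B)) \<circ>\<^sub>N \<eta> ?E"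
    by (simp add: c_def R.on_arr_Comp[OF Li e] N.Comp_assoc[OF unit_Hom[OF E] RLi R.on_arr_Hom[OF e]])
  also have "\<dots> = (Ra (\<epsilon> ?Y) \<circ>\<^sub>N \<eta> (Ro ?Y)) \<circ>\<^sub>N incl B"
    by (simp add: unit_nat[OF i(3), symmetric] N.Comp_assoc[OF i(3) u R.on_arr_Hom[OF e]])
  also have "\<dots> = incl B"
    by (simp add: triangle_right[OF d(1)] N.Id_Comp[OF i(3)])
  finally show Rc: "Ra c \<circ>\<^sub>N \<eta> ?E = incl B" .
  \<comment> \<open>The coalgebra square of \<open>c\<close>: both sides equal L applied to the
    inclusion, one by the adjunct formula \<open>Rc\<close> and the other by
    \<open>dc\<close>.\<close>
  have "La (Ra c) \<circ>\<^sub>M La (\<eta> ?E) = snd B \<circ>\<^sub>M c"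
    using L.on_arr_Comp[OF unit_Hom[OF E] R.on_arr_Hom[OF c]] Rc dc by simp
  then show "acounit cadj B \<in> Hom coA (on_ob can ?E) B"
    using B c coalgebra_Can[OF E] by (simp add: Hom_coAlg_iff c_def)
qed

text \<open>Naturality of the unit and the second triangle identity are checked after composing with
  \<open>incl\<close>, which is cancellable. For the other two, the equation defining a
  factorization through \<open>incl\<close> is put under L, which leaves naturality of \<epsilon>
  and the triangle identity of \<open>A\<close>.\<close>

lemma adjunction_comparison: "adjunction N coA cadj"
proof -
  interpret Q: category coA by (rule category_coAlg)
  interpret C: cat_functor N coA can by (rule cat_functor_Can)
  interpret V: cat_functor coA N VV by (rule cat_functor_V)
  interpret VC: cat_functor N N "comp_fctr VV can"
    by (rule comp_cat_functor[OF cat_functor_Can cat_functor_V])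
  interpret CV: cat_functor coA coA "comp_fctr can VV"
    by (rule comp_cat_functor[OF cat_functor_V cat_functor_Can])
  interpret I: cat_functor N N id_fctr by (rule N.id_cat_functor)
  interpret I': cat_functor coA coA id_fctr by (rule Q.id_cat_functor)
  have "nat_transformation N N id_fctr (comp_fctr VV can) (aunit cadj)"
  proof (unfold_locales, goal_cases)
    case (1 X)
    then show ?case using comparison_unit(1) by simp
  next
    case (2 f X Y)
    note XY = N.Hom_Ob[OF 2]
    let ?B = "\<lambda>X. (Lo X, La (\<eta> X))"
    note u = comparison_unit[OF XY(1)] and u' = comparison_unit[OF XY(2)]
    note i = equalizer_incl(3)[OF coalgebra_Can[OF XY(1)]]
      and i' = equalizer_incl(3)[OF coalgebra_Can[OF XY(2)]]
    note RLf = R.on_arr_Hom[OF L.on_arr_Hom[OF 2]]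
    have Cf: "(?B X, La f, ?B Y) \<in> Hom coA (?B X) (?B Y)"
      using C.on_arr_Hom[OF 2] 2 by simp
    note V = V_arr[OF Cf]
    have "incl (?B Y) \<circ>\<^sub>N aunit cadj Y \<circ>\<^sub>N f = \<eta> Y \<circ>\<^sub>N f"
      using N.Comp_assoc[OF 2 u'(1) i'] u'(2) by (simp del: cadj_simps)
    also have "\<dots> = Ra (La f) \<circ>\<^sub>N incl (?B X) \<circ>\<^sub>N aunit cadj X"
      using u(2) by (simp add: unit_nat[OF 2] del: cadj_simps)
    also have "\<dots> = (Ra (La f) \<circ>\<^sub>N incl (?B X)) \<circ>\<^sub>N aunit cadj X"
      by (rule N.Comp_assoc[symmetric, OF u(1)]) (use i RLf in auto)
    also have "\<dots> = incl (?B Y) \<circ>\<^sub>N on_arr VV (?B X, La f, ?B Y) \<circ>\<^sub>N aunit cadj X"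
      using N.Comp_assoc[OF u(1) V(1) i'] V(2) by (simp del: cadj_simps)
    finally have "aunit cadj Y \<circ>\<^sub>N f = on_arr VV (?B X, La f, ?B Y) \<circ>\<^sub>N aunit cadj X"
      by (rule incl_mono[OF coalgebra_Can[OF XY(2)] N.Comp_Hom[OF 2 u'(1)] N.Comp_Hom[OF u(1) V(1)]])
    then show ?case using 2 by (simp del: cadj_simps)
  qed
  moreover have "nat_transformation coA coA (comp_fctr can VV) id_fctr (acounit cadj)"
  proof (unfold_locales, goal_cases)
    case (1 X)
    then show ?case using comparison_counit(4) by simp
  next
    case (2 f B B')
    then obtain f' where [simp]: "f = (B, f', B')" by (auto simp: Hom_coAlg_iff)
    have B: "coalgebra M K B" and B': "coalgebra M K B'" and f: "f' \<in> Hom M (fst B) (fst B')"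
      using 2 by (auto simp: Hom_coAlg_iff)
    note V = V_arr[OF 2[simplified]]
    note i = equalizer_incl(3)[OF B] and i' = equalizer_incl(3)[OF B']
    note e = counit_Hom[OF coalgebraD(1)[OF B]] and e' = counit_Hom[OF coalgebraD(1)[OF B']]
    note LRf = L.on_arr_Hom[OF R.on_arr_Hom[OF f]]
    have "(\<epsilon> (fst B') \<circ>\<^sub>M La (incl B')) \<circ>\<^sub>M La (on_arr VV f)
        = \<epsilon> (fst B') \<circ>\<^sub>M La (incl B' \<circ>\<^sub>N on_arr VV f)"
      using V(1) by (simp add: L.on_arr_Comp[OF V(1) i']
          M.Comp_assoc[OF L.on_arr_Hom[OF V(1)] L.on_arr_Hom[OF i'] e'])
    also have "\<dots> = (\<epsilon> (fst B') \<circ>\<^sub>M La (Ra f')) \<circ>\<^sub>M La (incl B)"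
      using V(2) by (simp add: L.on_arr_Comp[OF i R.on_arr_Hom[OF f]]
          M.Comp_assoc[OF L.on_arr_Hom[OF i] LRf e'])
    also have "\<dots> = f' \<circ>\<^sub>M \<epsilon> (fst B) \<circ>\<^sub>M La (incl B)"
      by (simp add: counit_nat[OF f] M.Comp_assoc[OF L.on_arr_Hom[OF i] e f])
    finally show ?case using V(1) by simp
  qed
  moreover have "Comp coA (acounit cadj (on_ob can X)) (on_arr can (aunit cadj X)) = Id coA (on_ob can X)"
    if X: "X \<in> Ob N" for X
  proof -
    note u = comparison_unit[OF X] and i = equalizer_incl(3)[OF coalgebra_Can[OF X]]
    have "(\<epsilon> (Lo X) \<circ>\<^sub>M La (incl (Lo X, La (\<eta> X)))) \<circ>\<^sub>M La (aunit cadj X)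
        = \<epsilon> (Lo X) \<circ>\<^sub>M La (incl (Lo X, La (\<eta> X)) \<circ>\<^sub>N aunit cadj X)"
      using M.Comp_assoc[OF L.on_arr_Hom[OF u(1)] L.on_arr_Hom[OF i]] counit_Hom[OF L.on_ob_Ob[OF X]]
      by (simp add: L.on_arr_Comp[OF u(1) i] del: cadj_simps)
    also have "\<dots> = Id M (Lo X)"
      using u(2) triangle_left[OF X] by (simp del: cadj_simps)
    finally show ?thesis using u(1) by simp
  qed
  moreover have "on_arr VV (acounit cadj B) \<circ>\<^sub>N aunit cadj (on_ob VV B) = Id N (on_ob VV B)"
    if "B \<in> Ob coA" for B
  proof -
    have B: "coalgebra M K B" using that by simp
    note c = comparison_counit[OF B] and i = equalizer_incl(3)[OF B]
    let ?E = "on_ob VV B" and ?c = "\<epsilon> (fst B) \<circ>\<^sub>M La (incl B)"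
    have E: "?E \<in> Ob N" using i N.Hom_Ob by blast
    let ?C = "(Lo ?E, La (\<eta> ?E))"
    note u = comparison_unit[OF E] and j = equalizer_incl(3)[OF coalgebra_Can[OF E]]
    note V = V_arr[OF c(4)[simplified]]
    have "incl B \<circ>\<^sub>N on_arr VV (?C, ?c, B) \<circ>\<^sub>N aunit cadj ?E = Ra ?c \<circ>\<^sub>N incl ?C \<circ>\<^sub>N aunit cadj ?E"
      using N.Comp_assoc[OF u(1) V(1) i] V(2) N.Comp_assoc[OF u(1) j] R.on_arr_Hom[OF c(1)]
      by (simp del: cadj_simps)
    also have "\<dots> = incl B \<circ>\<^sub>N Id N ?E"
      using u(2) c(3) N.Comp_Id[OF i] by (simp del: cadj_simps)
    finally show ?thesis
      using incl_mono[OF B N.Comp_Hom[OF u(1) V(1)] N.Id_Hom[OF E]] by simp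
  qed
  ultimately show ?thesis
    using cat_functor_Can cat_functor_V by (simp add: adjunction_def del: cadj_simps(3-) coAlg_simps)
qed

text \<open>Preservation makes L of the inclusion an equalizer of the pair for which the coaction is
  a split equalizer; the underlying arrow of the counit compares the two, and its inverse lifts to
  coalgebras.\<close>

lemma is_iso_comparison_counit:
  assumes B: "coalgebra M K B"
  shows "is_iso coA (acounit cadj B)"
proof -
  note c = comparison_counit[OF B] and i = equalizer_incl[OF B]
  have "is_iso M (\<epsilon> (fst B) \<circ>\<^sub>M La (incl B))"
    using M.is_iso_between_equalizers[OF i(2) L.on_arr_Hom[OF i(3)] equalizer_coaction[OF B]
        coalgebraD(2)[OF B] c(1,2)] .
  then show ?thesis using is_iso_coAlg c(4) by simp
qed

text \<open>\<open>L\<close> sends the unit at \<open>X\<close> to the comparison between two equalizers of the same pair, one of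
  which is the split equalizer of the coalgebra \<open>(LX, L\<eta>\<^sub>X)\<close>.\<close>

lemma is_iso_comparison_unit:
  assumes X: "X \<in> Ob N"
  shows "is_iso N (aunit cadj X)"
proof -
  note B = coalgebra_Can[OF X]
  note u = comparison_unit[OF X] and i = equalizer_incl[OF B]
  have "is_iso M (La (aunit cadj X))"
  proof (rule M.is_iso_between_equalizers[OF equalizer_coaction[OF B] coalgebraD(2)[OF B]])
    show "equalizer M (La (incl (Lo X, La (\<eta> X)))) (La (Ra (snd (Lo X, La (\<eta> X)))))
        (La (\<eta> (Ro (fst (Lo X, La (\<eta> X))))))"
      by (rule i(2))
    show "La (incl (Lo X, La (\<eta> X)))
        \<in> Hom M (Lo (on_ob VV (Lo X, La (\<eta> X)))) (Lo (Ro (fst (Lo X, La (\<eta> X)))))"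
      by (rule L.on_arr_Hom[OF i(3)])
    show "La (aunit cadj X) \<in> Hom M (fst (Lo X, La (\<eta> X))) (Lo (on_ob VV (Lo X, La (\<eta> X))))"
      using L.on_arr_Hom[OF u(1)] by (simp del: cadj_simps)
    show "La (incl (Lo X, La (\<eta> X))) \<circ>\<^sub>M La (aunit cadj X) = snd (Lo X, La (\<eta> X))"
      using L.on_arr_Comp[OF u(1) i(3)] u(2) by (simp del: cadj_simps)
  qed
  then show ?thesis using reflects_iso HomD(1)[OF u(1)] by blast
qed

theorem adjoint_equivalence_comparison: "adjoint_equivalence N coA cadj"
  using adjunction_comparison is_iso_comparison_counit is_iso_comparison_unit
  by (simp add: adjoint_equivalence_def del: cadj_simps)

text \<open>\<open>VV\<close> is the quasi-inverse, with the unit and counit of the adjoint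
  equivalence as natural isomorphisms.\<close>

theorem comonadic: "comonadic N M A"
proof -
  have "cat_functor N coA can" "cat_functor coA N VV"
    "nat_transformation N N id_fctr (comp_fctr VV can) (aunit cadj)"
    "nat_transformation coA coA (comp_fctr can VV) id_fctr (acounit cadj)"
    using adjunction_comparison by (simp_all add: adjunction_def del: cadj_simps(3-))
  moreover have "\<forall>X \<in> Ob N. is_iso N (aunit cadj X)" "\<forall>B \<in> Ob coA. is_iso coA (acounit cadj B)"
    using is_iso_comparison_unit is_iso_comparison_counit by (auto simp del: cadj_simps)
  ultimately show ?thesis
    unfolding comonadic_def equivalence_of_categories_def nat_iso_def by blast
qed

end

subsection \<open>The category of pointed simplicial sets\<close>

lemma Delta_mem: "\<theta> \<in> Delta m n \<Longrightarrow> i \<le> m \<Longrightarrow> \<theta> i \<le> n"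
  and Delta_mono: "\<theta> \<in> Delta m n \<Longrightarrow> i \<le> j \<Longrightarrow> j \<le> m \<Longrightarrow> \<theta> i \<le> \<theta> j"
  by (auto simp: Delta_def mono_on_def PiE_def Pi_def)

lemma DeltaI:
  assumes "\<And>i. i \<le> m \<Longrightarrow> \<theta> i \<le> n" "\<And>i j. i \<le> j \<Longrightarrow> j \<le> m \<Longrightarrow> \<theta> i \<le> \<theta> j"
    and "\<theta> \<in> extensional {..m}"
  shows "\<theta> \<in> Delta m n"
  using assms by (auto simp: Delta_def mono_on_def PiE_def Pi_def)

lemma Delta_extensional: "\<theta> \<in> Delta m n \<Longrightarrow> \<theta> \<in> extensional {..m}"
  by (auto simp: Delta_def PiE_def)

lemma Delta_id: "restrict id {..n} \<in> Delta n n"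
  by (rule DeltaI) auto

lemma Delta_const: "(\<lambda>i\<in>{..m}. 0) \<in> Delta m n"
  by (rule DeltaI) auto

lemma Delta_compose:
  assumes "\<phi> \<in> Delta k m" "\<theta> \<in> Delta m n"
  shows "compose {..k} \<theta> \<phi> \<in> Delta k n"
  by (rule DeltaI)
    (use assms in \<open>auto simp: compose_def intro!: Delta_mem[OF assms(2)] Delta_mono[OF assms(2)]
       Delta_mem[OF assms(1)] Delta_mono[OF assms(1)]\<close>)

lemma Delta_compose_id [simp]:
  assumes "\<theta> \<in> Delta m n"
  shows "compose {..m} \<theta> (restrict id {..m}) = \<theta>" "compose {..m} (restrict id {..n}) \<theta> = \<theta>"
  by (rule extensionalityI[of _ "{..m}"];
      use assms in \<open>auto simp: compose_def Delta_extensional Delta_mem\<close>)+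

lemma Delta_compose_assoc:
  assumes "\<psi> \<in> Delta j k" "\<phi> \<in> Delta k m"
  shows "compose {..j} (compose {..k} \<theta> \<phi>) \<psi> = compose {..j} \<theta> (compose {..j} \<phi> \<psi>)"
  by (rule extensionalityI[of _ "{..j}"])
    (use assms in \<open>auto simp: compose_def Delta_mem\<close>)

lemma pointed_ssetD:
  assumes "pointed_sset X"
  shows act_cells: "\<theta> \<in> Delta m n \<Longrightarrow> x \<in> cells X n \<Longrightarrow> act X m n \<theta> x \<in> cells X m"
    and act_id: "x \<in> cells X n \<Longrightarrow> act X n n (restrict id {..n}) x = x"
    and act_compose: "\<phi> \<in> Delta k m \<Longrightarrow> \<theta> \<in> Delta m n \<Longrightarrow> x \<in> cells X n \<Longrightarrow>
      act X k n (compose {..k} \<theta> \<phi>) x = act X k m \<phi> (act X m n \<theta> x)"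
    and pt_cells: "pt X n \<in> cells X n"
    and act_pt: "\<theta> \<in> Delta m n \<Longrightarrow> act X m n \<theta> (pt X n) = pt X m"
  using assms by (simp_all add: pointed_sset_def Pi_iff)

lemma pointed_ssetI:
  assumes "\<And>m n \<theta> x. \<theta> \<in> Delta m n \<Longrightarrow> x \<in> cells X n \<Longrightarrow> act X m n \<theta> x \<in> cells X m"
    and "\<And>n x. x \<in> cells X n \<Longrightarrow> act X n n (restrict id {..n}) x = x"
    and "\<And>k m n \<phi> \<theta> x. \<phi> \<in> Delta k m \<Longrightarrow> \<theta> \<in> Delta m n \<Longrightarrow> x \<in> cells X n \<Longrightarrow>
      act X k n (compose {..k} \<theta> \<phi>) x = act X k m \<phi> (act X m n \<theta> x)"
    and "\<And>n. pt X n \<in> cells X n"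
    and "\<And>m n \<theta>. \<theta> \<in> Delta m n \<Longrightarrow> act X m n \<theta> (pt X n) = pt X m"
  shows "pointed_sset X"
  using assms by (simp add: pointed_sset_def)

lemma ps_mapsD:
  assumes "f \<in> ps_maps X Y"
  shows ps_maps_cells: "x \<in> cells X n \<Longrightarrow> f n x \<in> cells Y n"
    and ps_maps_act: "\<theta> \<in> Delta m n \<Longrightarrow> x \<in> cells X n \<Longrightarrow> f m (act X m n \<theta> x) = act Y m n \<theta> (f n x)"
    and ps_maps_pt: "f n (pt X n) = pt Y n"
    and ps_maps_extensional: "f n \<in> extensional (cells X n)"
  using assms by (auto simp: ps_maps_def PiE_def)

lemma ps_mapsI:
  assumes "\<And>n x. x \<in> cells X n \<Longrightarrow> f n x \<in> cells Y n"
    and "\<And>m n \<theta> x. \<theta> \<in> Delta m n \<Longrightarrow> x \<in> cells X n \<Longrightarrow> f m (act X m n \<theta> x) = act Y m n \<theta> (f n x)"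
    and "\<And>n. f n (pt X n) = pt Y n"
    and "\<And>n. f n \<in> extensional (cells X n)"
  shows "f \<in> ps_maps X Y"
  using assms by (auto simp: ps_maps_def PiE_def)

text \<open>Maps are extensional on the simplices of the domain, so agreement there is equality;
  every identity between simplicial maps below is proved this way.\<close>

lemma ps_maps_eqI:
  assumes "f \<in> ps_maps X Y" "g \<in> ps_maps X Z" "\<And>n x. x \<in> cells X n \<Longrightarrow> f n x = g n x"
  shows "f = g"
proof
  show "f n = g n" for n
    using assms by (intro extensionalityI[of _ "cells X n"]) (auto intro: ps_maps_extensional)
qed

lemma ps_id_apply [simp]: "x \<in> cells X n \<Longrightarrow> ps_id X n x = x"
  by (simp add: ps_id_def)

lemma ps_comp_apply [simp]: "x \<in> cells X n \<Longrightarrow> ps_comp X g f n x = g n (f n x)"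
  by (simp add: ps_comp_def compose_def)

lemma ps_id_maps: "pointed_sset X \<Longrightarrow> ps_id X \<in> ps_maps X X"
  by (rule ps_mapsI) (simp_all add: act_cells pt_cells, simp add: ps_id_def)

lemma ps_comp_maps:
  assumes "pointed_sset X" "f \<in> ps_maps X Y" "g \<in> ps_maps Y Z"
  shows "ps_comp X g f \<in> ps_maps X Z"
  by (rule ps_mapsI)
    (use assms in \<open>simp_all add: act_cells pt_cells ps_maps_cells[OF assms(2)] ps_maps_cells[OF assms(3)]
       ps_maps_act[OF assms(2)] ps_maps_act[OF assms(3)] ps_maps_pt[OF assms(2)] ps_maps_pt[OF assms(3)]\<close>,
     simp add: ps_comp_def)

lemma Hom_sSet_pt:
  "\<phi> \<in> Hom sSet_pt X Y \<longleftrightarrow>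
     pointed_sset X \<and> pointed_sset Y \<and> (\<exists>f \<in> ps_maps X Y. \<phi> = (X, f, Y))"
  unfolding Hom_def[of sSet_pt] by (auto simp: sSet_pt_def)

lemma sSet_pt_simps [simp]:
  "Ob sSet_pt = {X. pointed_sset X}"
  "Id sSet_pt X = (X, ps_id X, X)"
  "Comp sSet_pt (Y', g, Z) (X, f, Y) = (X, ps_comp X g f, Z)"
  by (simp_all add: sSet_pt_def)

lemma category_sSet_pt: "category sSet_pt"
proof (unfold_locales, goal_cases)
  case (1 f)
  then show ?case by (auto simp: sSet_pt_def)
next
  case (2 f)
  then show ?case by (auto simp: sSet_pt_def)
next
  case (3 X)
  then show ?case by (simp add: Hom_sSet_pt ps_id_maps)
next
  case (4 f X Y g Z)
  then show ?case by (auto simp: Hom_sSet_pt intro: ps_comp_maps)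
next
  case (5 f X Y)
  then obtain f' where f: "f = (X, f', Y)" "f' \<in> ps_maps X Y" and X: "pointed_sset X"
    by (auto simp: Hom_sSet_pt)
  have "ps_comp X f' (ps_id X) = f'"
    by (rule ps_maps_eqI[OF ps_comp_maps[OF X ps_id_maps[OF X] f(2)] f(2)]) simp
  then show ?case using f by simp
next
  case (6 f X Y)
  then obtain f' where f: "f = (X, f', Y)" "f' \<in> ps_maps X Y" and X: "pointed_sset X" "pointed_sset Y"
    by (auto simp: Hom_sSet_pt)
  have "ps_comp X (ps_id Y) f' = f'"
    by (rule ps_maps_eqI[OF ps_comp_maps[OF X(1) f(2) ps_id_maps[OF X(2)]] f(2)])
      (simp add: ps_maps_cells[OF f(2)])
  then show ?case using f by simp
next
  case (7 f W X g Y h Z)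
  then obtain f' g' h' where f: "f = (W, f', X)" "f' \<in> ps_maps W X" "g = (X, g', Y)" "g' \<in> ps_maps X Y"
    "h = (Y, h', Z)" "h' \<in> ps_maps Y Z" and W: "pointed_sset W" "pointed_sset X"
    by (auto simp: Hom_sSet_pt)
  have "ps_comp W (ps_comp X h' g') f' = ps_comp W h' (ps_comp W g' f')"
    by (rule ps_maps_eqI[OF ps_comp_maps[OF W(1) f(2) ps_comp_maps[OF W(2) f(4,6)]]
          ps_comp_maps[OF W(1) ps_comp_maps[OF W(1) f(2,4)] f(6)]])
      (simp add: ps_maps_cells[OF f(2)])
  then show ?case using f by simp
qed

interpretation sSet: category sSet_pt
  by (rule category_sSet_pt)

lemma ps_rename_simps [simp]:
  "cells (ps_rename \<iota> X) n = \<iota> ` cells X n"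
  "pt (ps_rename \<iota> X) n = \<iota> (pt X n)"
  "inj \<iota> \<Longrightarrow> act (ps_rename \<iota> X) m n \<theta> (\<iota> x) = \<iota> (act X m n \<theta> x)"
  by (simp_all add: ps_rename_def)

lemma map_rename_apply [simp]:
  "inj \<iota> \<Longrightarrow> x \<in> cells X n \<Longrightarrow> map_rename \<iota> \<kappa> X f n (\<iota> x) = \<kappa> (f n x)"
  by (simp add: map_rename_def)

lemma pointed_sset_rename:
  assumes "inj \<iota>" "pointed_sset X"
  shows "pointed_sset (ps_rename \<iota> X)"
  by (rule pointed_ssetI)
    (use assms in \<open>auto simp: act_cells act_id act_compose act_pt pt_cells\<close>)

lemma map_rename_maps:
  assumes "inj \<iota>" "inj \<kappa>" "pointed_sset X" and f: "f \<in> ps_maps X Y"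
  shows "map_rename \<iota> \<kappa> X f \<in> ps_maps (ps_rename \<iota> X) (ps_rename \<kappa> Y)"
  by (rule ps_mapsI)
    (use assms in \<open>auto simp: act_cells pt_cells ps_maps_cells[OF f] ps_maps_act[OF f] ps_maps_pt[OF f]\<close>,
     simp add: map_rename_def)

subsection \<open>Suspension and loop functors\<close>

lemma smash_class_cells: "x \<in> cells X n \<Longrightarrow> y \<in> cells Y n \<Longrightarrow> smash_class X Y n x y \<in> cells (smash X Y) n"
  by (auto simp: smash_def)

lemma smash_cellsE:
  assumes "z \<in> cells (smash X Y) n"
  obtains x y where "x \<in> cells X n" "y \<in> cells Y n" "z = smash_class X Y n x y"
  using assms by (auto simp: smash_def)

lemma smash_class_pt [simp]: "smash_class X Y n (pt X n) y = None" "smash_class X Y n x (pt Y n) = None"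
  by (simp_all add: smash_class_def)

lemma smash_class_eq_iff:
  "smash_class X Y n x y = smash_class X Y n x' y' \<longleftrightarrow>
     x = x' \<and> y = y' \<or> (x = pt X n \<or> y = pt Y n) \<and> (x' = pt X n \<or> y' = pt Y n)"
  by (auto simp: smash_class_def)

lemma pt_smash [simp]: "pt (smash X Y) n = None"
  by (simp add: smash_def)

text \<open>The formula holds for collapsed representatives as well, because structure maps fix the
  base points. This lets later computations use \<open>smash_class\<close> without splitting on
  \<open>None\<close>.\<close>

lemma act_smash:
  assumes "pointed_sset X" "pointed_sset Y" "\<theta> \<in> Delta m n"
  shows "act (smash X Y) m n \<theta> (smash_class X Y n x y)
    = smash_class X Y m (act X m n \<theta> x) (act Y m n \<theta> y)"
  using assms by (auto simp: smash_def smash_class_def act_pt)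

text \<open>Collapsed representatives are covered because \<open>f\<close> and \<open>g\<close>
  preserve base points.\<close>

lemma smash_map_apply:
  assumes "f \<in> ps_maps X X'" "g \<in> ps_maps Y Y'" "x \<in> cells X n" "y \<in> cells Y n"
  shows "smash_map X Y X' Y' f g n (smash_class X Y n x y) = smash_class X' Y' n (f n x) (g n y)"
  using smash_class_cells[OF assms(3,4)] ps_maps_pt[OF assms(1)] ps_maps_pt[OF assms(2)]
  by (auto simp: smash_map_def smash_class_def)

lemma pointed_sset_smash:
  assumes X: "pointed_sset X" and Y: "pointed_sset Y"
  shows "pointed_sset (smash X Y)"
proof (rule pointed_ssetI, goal_cases)
  case (1 m n \<theta> x)
  then show ?case
    using X Y by (auto simp: act_smash act_cells elim!: smash_cellsE intro!: smash_class_cells)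
next
  case (2 n x)
  then show ?case
    using X Y by (auto simp: act_smash act_id Delta_id elim!: smash_cellsE)
next
  case (3 k m n \<phi> \<theta> x)
  then show ?case
    using X Y by (auto simp: act_smash act_compose Delta_compose elim!: smash_cellsE)
next
  case (4 n)
  then show ?case
    using smash_class_cells[OF pt_cells[OF X] pt_cells[OF Y], of n] by simp
next
  case (5 m n \<theta>)
  then show ?case by (simp add: smash_def)
qed

lemma smash_map_maps:
  assumes X: "pointed_sset X" "pointed_sset X'" and Y: "pointed_sset Y" "pointed_sset Y'"
    and f: "f \<in> ps_maps X X'" and g: "g \<in> ps_maps Y Y'"
  shows "smash_map X Y X' Y' f g \<in> ps_maps (smash X Y) (smash X' Y')"
proof (rule ps_mapsI, goal_cases)
  case (1 n z)
  then show ?case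
    by (auto simp: smash_map_apply[OF f g] ps_maps_cells[OF f] ps_maps_cells[OF g]
        elim!: smash_cellsE intro!: smash_class_cells)
next
  case (2 m n \<theta> z)
  then show ?case
    using X Y by (auto simp: smash_map_apply[OF f g] act_smash act_cells ps_maps_act[OF f] ps_maps_act[OF g]
        elim!: smash_cellsE)
next
  case (3 n)
  then show ?case
    using pt_cells[OF pointed_sset_smash[OF X(1) Y(1)], of n] by (simp add: smash_map_def)
next
  case (4 n)
  then show ?case by (simp add: smash_map_def)
qed

lemma inj_Sm: "inj Sm" and inj_Fn: "inj Fn"
  by (auto intro: injI)

lemma Susp_simps [simp]:
  "on_ob (Susp S) X = ps_rename Sm (smash X S)"
  "on_arr (Susp S) (X, f, Y) =
     (ps_rename Sm (smash X S), map_rename Sm Sm (smash X S) (smash_map X S Y S f (ps_id S)),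
      ps_rename Sm (smash Y S))"
  by (simp_all add: Susp_def Let_def)

lemma Susp_apply:
  assumes "pointed_sset S" "f \<in> ps_maps X Y" "x \<in> cells X n" "s \<in> cells S n"
  shows "map_rename Sm Sm (smash X S) (smash_map X S Y S f (ps_id S)) n (Sm (smash_class X S n x s))
    = Sm (smash_class Y S n (f n x) s)"
  using assms by (simp add: inj_Sm smash_class_cells smash_map_apply ps_id_maps)

lemma Susp_maps:
  assumes "pointed_sset S" "f \<in> ps_maps X Y" "pointed_sset X" "pointed_sset Y"
  shows "map_rename Sm Sm (smash X S) (smash_map X S Y S f (ps_id S))
    \<in> ps_maps (ps_rename Sm (smash X S)) (ps_rename Sm (smash Y S))"
  using assms by (simp add: inj_Sm map_rename_maps smash_map_maps pointed_sset_smash ps_id_maps)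

lemma pointed_sset_Susp:
  "pointed_sset S \<Longrightarrow> pointed_sset X \<Longrightarrow> pointed_sset (ps_rename Sm (smash X S))"
  by (simp add: inj_Sm pointed_sset_rename pointed_sset_smash)

lemma cat_functor_Susp:
  assumes S: "pointed_sset S"
  shows "cat_functor sSet_pt sSet_pt (Susp S)"
proof (unfold_locales, goal_cases)
  case (1 X)
  then show ?case using S by (simp add: pointed_sset_Susp)
next
  case (2 f X Y)
  then show ?case using S by (auto simp: Hom_sSet_pt pointed_sset_Susp Susp_maps)
next
  case (3 X)
  then have X: "pointed_sset X" by simp
  have "map_rename Sm Sm (smash X S) (smash_map X S X S (ps_id X) (ps_id S))
    = ps_id (ps_rename Sm (smash X S))"
    by (rule ps_maps_eqI[OF Susp_maps[OF S ps_id_maps[OF X] X X] ps_id_maps[OF pointed_sset_Susp[OF S X]]])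
      (auto simp: Susp_apply[OF S ps_id_maps[OF X]] smash_class_cells elim!: smash_cellsE)
  then show ?case by simp
next
  case (4 f X Y g Z)
  then obtain f' g' where f: "f = (X, f', Y)" "f' \<in> ps_maps X Y" and g: "g = (Y, g', Z)" "g' \<in> ps_maps Y Z"
    and p: "pointed_sset X" "pointed_sset Y" "pointed_sset Z"
    by (auto simp: Hom_sSet_pt)
  note gf = ps_comp_maps[OF p(1) f(2) g(2)]
  have "map_rename Sm Sm (smash X S) (smash_map X S Z S (ps_comp X g' f') (ps_id S))
    = ps_comp (ps_rename Sm (smash X S)) (map_rename Sm Sm (smash Y S) (smash_map Y S Z S g' (ps_id S)))
       (map_rename Sm Sm (smash X S) (smash_map X S Y S f' (ps_id S)))"
    by (rule ps_maps_eqI[OF Susp_maps[OF S gf p(1,3)] ps_comp_maps[OF pointed_sset_Susp[OF S p(1)]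
            Susp_maps[OF S f(2) p(1,2)] Susp_maps[OF S g(2) p(2,3)]]])
      (auto simp: Susp_apply[OF S f(2)] Susp_apply[OF S g(2)] Susp_apply[OF S gf]
         ps_maps_cells[OF f(2)] smash_class_cells elim!: smash_cellsE)
  then show ?case using f g by simp
qed

section \<open>Cylinders over standard simplices and mapping spaces\<close>

lemma cells_simplex_plus: "cells (simplex_plus n) k = insert None (Some ` Delta k n)"
  by (simp add: simplex_plus_def)

lemma act_simplex_plus: "act (simplex_plus n) j k \<phi> (Some \<alpha>) = Some (compose {..j} \<alpha> \<phi>)"
  by (simp add: simplex_plus_def)

lemma pointed_sset_simplex_plus: "pointed_sset (simplex_plus n)"
  by (rule pointed_ssetI)
    (auto simp: simplex_plus_def Delta_compose Delta_compose_assoc)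

lemma simplex_plus_map_apply [simp]:
  "\<alpha> \<in> Delta k m \<Longrightarrow> simplex_plus_map m n \<theta> k (Some \<alpha>) = Some (compose {..k} \<theta> \<alpha>)"
  by (simp add: simplex_plus_map_def cells_simplex_plus)

lemma simplex_plus_map_maps:
  assumes "\<theta> \<in> Delta m n"
  shows "simplex_plus_map m n \<theta> \<in> ps_maps (simplex_plus m) (simplex_plus n)"
  by (rule ps_mapsI)
    (use assms in \<open>auto simp: simplex_plus_def simplex_plus_map_def Delta_compose Delta_compose_assoc\<close>)

abbreviation cyl :: "'s psset \<Rightarrow> nat \<Rightarrow> ('s \<times> (nat \<Rightarrow> nat) option) option psset" where
  "cyl S n \<equiv> smash S (simplex_plus n)"

text \<open>The class of a simplex of S paired with a simplex of the standard simplex, without the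
  option layer for the disjoint base point.\<close>

definition cyl_cell :: "'s psset \<Rightarrow> nat \<Rightarrow> nat \<Rightarrow> 's \<Rightarrow> (nat \<Rightarrow> nat) \<Rightarrow> ('s \<times> (nat \<Rightarrow> nat) option) option" where
  "cyl_cell S n k s \<alpha> = smash_class S (simplex_plus n) k s (Some \<alpha>)"

lemma cyl_cell_alt: "cyl_cell S n k s \<alpha> = (if s = pt S k then None else Some (s, Some \<alpha>))"
  by (simp add: cyl_cell_def smash_class_def simplex_plus_def)

lemma pointed_sset_cyl: "pointed_sset S \<Longrightarrow> pointed_sset (cyl S n)"
  by (simp add: pointed_sset_smash pointed_sset_simplex_plus)

lemma cyl_cell_cells: "s \<in> cells S k \<Longrightarrow> \<alpha> \<in> Delta k n \<Longrightarrow> cyl_cell S n k s \<alpha> \<in> cells (cyl S n) k"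
  by (simp add: cyl_cell_def smash_class_cells cells_simplex_plus)

lemma cyl_cellsE:
  assumes "z \<in> cells (cyl S n) k" and S: "pointed_sset S"
  obtains s \<alpha> where "s \<in> cells S k" "\<alpha> \<in> Delta k n" "z = cyl_cell S n k s \<alpha>"
proof -
  obtain s a where s: "s \<in> cells S k" and a: "a \<in> cells (simplex_plus n) k"
    and z: "z = smash_class S (simplex_plus n) k s a"
    using assms(1) by (rule smash_cellsE)
  show ?thesis
  proof (cases a)
    case None
    \<comment> \<open>The base point is also of the form \<open>cyl_cell\<close>: with the base
      point of S in the first place, any operator may stand in the second, and the constant one
      always exists. Case analyses on cylinders thus have a single case.\<close>
    then have "z = cyl_cell S n k (pt S k) (\<lambda>i\<in>{..k}. 0)"
      using z by (simp add: cyl_cell_alt smash_class_def simplex_plus_def)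
    then show ?thesis using that pt_cells[OF S] Delta_const by blast
  next
    case (Some \<alpha>)
    then show ?thesis using that s a z by (auto simp: cyl_cell_def cells_simplex_plus)
  qed
qed

lemma act_cyl:
  assumes "pointed_sset S" "\<phi> \<in> Delta j k"
  shows "act (cyl S n) j k \<phi> (cyl_cell S n k s \<alpha>) = cyl_cell S n j (act S j k \<phi> s) (compose {..j} \<alpha> \<phi>)"
  using act_smash[OF assms(1) pointed_sset_simplex_plus assms(2)]
  by (simp add: cyl_cell_def act_simplex_plus)

text \<open>The map of cylinders induced by \<theta>; precomposition with it is the structure map of
  the mapping space.\<close>

definition cyl_map :: "'s psset \<Rightarrow> nat \<Rightarrow> nat \<Rightarrow> (nat \<Rightarrow> nat) \<Rightarrow> nat \<Rightarrow>
    ('s \<times> (nat \<Rightarrow> nat) option) option \<Rightarrow> ('s \<times> (nat \<Rightarrow> nat) option) option" where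
  "cyl_map S m n \<theta> =
     smash_map S (simplex_plus m) S (simplex_plus n) (ps_id S) (simplex_plus_map m n \<theta>)"

lemma cyl_map_apply:
  assumes "pointed_sset S" "\<theta> \<in> Delta m n" "s \<in> cells S k" "\<alpha> \<in> Delta k m"
  shows "cyl_map S m n \<theta> k (cyl_cell S m k s \<alpha>) = cyl_cell S n k s (compose {..k} \<theta> \<alpha>)"
  using assms smash_map_apply[OF ps_id_maps[OF assms(1)] simplex_plus_map_maps[OF assms(2)] assms(3)]
  by (simp add: cyl_map_def cyl_cell_def cells_simplex_plus)

lemma cyl_map_maps:
  assumes "pointed_sset S" "\<theta> \<in> Delta m n"
  shows "cyl_map S m n \<theta> \<in> ps_maps (cyl S m) (cyl S n)"
  using assms
  by (simp add: cyl_map_def smash_map_maps pointed_sset_simplex_plus ps_id_maps simplex_plus_map_maps)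

lemma cyl_maps_eqI:
  assumes "pointed_sset S" "f \<in> ps_maps (cyl S n) X" "g \<in> ps_maps (cyl S n) Y"
    and "\<And>k s \<alpha>. s \<in> cells S k \<Longrightarrow> \<alpha> \<in> Delta k n \<Longrightarrow> f k (cyl_cell S n k s \<alpha>) = g k (cyl_cell S n k s \<alpha>)"
  shows "f = g"
  using assms by (auto intro!: ps_maps_eqI[OF assms(2,3)] elim!: cyl_cellsE)

lemma mapping_space_simps [simp]:
  "cells (mapping_space S X) n = ps_maps (cyl S n) X"
  "act (mapping_space S X) m n \<theta> h = ps_comp (cyl S m) h (cyl_map S m n \<theta>)"
  "pt (mapping_space S X) n = (\<lambda>k. \<lambda>z \<in> cells (cyl S n) k. pt X k)"
  by (simp_all add: mapping_space_def cyl_map_def)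

lemma const_maps:
  assumes "pointed_sset X" "pointed_sset Y"
  shows "(\<lambda>k. \<lambda>z \<in> cells X k. pt Y k) \<in> ps_maps X Y"
  by (rule ps_mapsI) (use assms in \<open>auto simp: pt_cells act_cells act_pt\<close>)

text \<open>An operator acts by precomposition with \<open>cyl_map\<close>, which changes only the
  second factor by composing with that operator; the laws reduce to unit and associativity laws of
  monotone maps.\<close>

lemma pointed_sset_mapping_space:
  assumes S: "pointed_sset S" and X: "pointed_sset X"
  shows "pointed_sset (mapping_space S X)"
proof (rule pointed_ssetI, goal_cases)
  case (1 m n \<theta> h)
  then show ?case
    using S by (auto intro!: ps_comp_maps[OF _ cyl_map_maps] simp: pointed_sset_cyl)
next
  case (2 n h)
  then have h: "h \<in> ps_maps (cyl S n) X" by simp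
  have "ps_comp (cyl S n) h (cyl_map S n n (restrict id {..n})) = h"
    by (rule cyl_maps_eqI[OF S ps_comp_maps[OF pointed_sset_cyl[OF S] cyl_map_maps[OF S Delta_id] h] h])
      (simp add: cyl_cell_cells cyl_map_apply[OF S Delta_id])
  then show ?case by simp
next
  case (3 k m n \<phi> \<theta> h)
  then have h: "h \<in> ps_maps (cyl S n) X" and \<phi>: "\<phi> \<in> Delta k m" and \<theta>: "\<theta> \<in> Delta m n" by simp_all
  note c = pointed_sset_cyl[OF S]
  have "ps_comp (cyl S k) h (cyl_map S k n (compose {..k} \<theta> \<phi>))
    = ps_comp (cyl S k) (ps_comp (cyl S m) h (cyl_map S m n \<theta>)) (cyl_map S k m \<phi>)"
    by (rule cyl_maps_eqI[OF S ps_comp_maps[OF c cyl_map_maps[OF S Delta_compose[OF \<phi> \<theta>]] h]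
          ps_comp_maps[OF c cyl_map_maps[OF S \<phi>] ps_comp_maps[OF c cyl_map_maps[OF S \<theta>] h]]])
      (simp add: cyl_cell_cells cyl_map_apply[OF S] \<theta> \<phi> Delta_compose[OF _ \<phi>] Delta_compose[OF \<phi> \<theta>]
         Delta_compose_assoc[OF _ \<phi>])
  then show ?case by simp
next
  case (4 n)
  then show ?case using const_maps[OF pointed_sset_cyl[OF S] X] by simp
next
  case (5 m n \<theta>)
  note c = pointed_sset_cyl[OF S]
  have "ps_comp (cyl S m) (\<lambda>k. \<lambda>z \<in> cells (cyl S n) k. pt X k) (cyl_map S m n \<theta>)
    = (\<lambda>k. \<lambda>z \<in> cells (cyl S m) k. pt X k)"
    by (rule cyl_maps_eqI[OF S ps_comp_maps[OF c cyl_map_maps[OF S 5] const_maps[OF c X]] const_maps[OF c X]])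
      (simp add: cyl_cell_cells cyl_map_apply[OF S 5] Delta_compose[OF _ 5])
  then show ?case by simp
qed

lemma mapping_space_map_apply [simp]:
  "h \<in> ps_maps (cyl S n) X \<Longrightarrow> mapping_space_map S X f n h = ps_comp (cyl S n) f h"
  by (simp add: mapping_space_map_def)

lemma ps_comp_assoc:
  assumes "f \<in> ps_maps X Y"
  shows "ps_comp X (ps_comp Y h g) f = ps_comp X h (ps_comp X g f)"
proof
  show "ps_comp X (ps_comp Y h g) f n = ps_comp X h (ps_comp X g f) n" for n
    using ps_maps_cells[OF assms]
    by (intro extensionalityI[of _ "cells X n"]) (simp_all, simp_all add: ps_comp_def)
qed

lemma mapping_space_map_maps:
  assumes S: "pointed_sset S" and X: "pointed_sset X" and f: "f \<in> ps_maps X Y"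
  shows "mapping_space_map S X f \<in> ps_maps (mapping_space S X) (mapping_space S Y)"
proof (rule ps_mapsI, goal_cases)
  case (1 n h)
  then show ?case using ps_comp_maps[OF pointed_sset_cyl[OF S] _ f] by simp
next
  case (2 m n \<theta> h)
  then have h: "h \<in> ps_maps (cyl S n) X" by simp
  show ?case
    using h ps_comp_maps[OF pointed_sset_cyl[OF S] cyl_map_maps[OF S 2(1)] h]
    by (simp add: ps_comp_assoc[OF cyl_map_maps[OF S 2(1)]])
next
  case (3 n)
  note c = const_maps[OF pointed_sset_cyl[OF S] X, of n]
  have "ps_comp (cyl S n) f (\<lambda>k. \<lambda>z \<in> cells (cyl S n) k. pt X k) = (\<lambda>k. \<lambda>z \<in> cells (cyl S n) k. pt Y k)"
    by (intro ext) (simp add: ps_comp_def compose_def ps_maps_pt[OF f])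
  then show ?case using c by simp
next
  case (4 n)
  then show ?case by (simp add: mapping_space_map_def)
qed

lemma Loop_simps [simp]:
  "on_ob (Loop S) X = ps_rename Fn (mapping_space S X)"
  "on_arr (Loop S) (X, f, Y) =
     (ps_rename Fn (mapping_space S X), map_rename Fn Fn (mapping_space S X) (mapping_space_map S X f),
      ps_rename Fn (mapping_space S Y))"
  by (simp_all add: Loop_def Let_def)

lemma Loop_apply:
  assumes "h \<in> ps_maps (cyl S n) X"
  shows "map_rename Fn Fn (mapping_space S X) (mapping_space_map S X f) n (Fn h)
    = Fn (ps_comp (cyl S n) f h)"
  using assms by (simp add: inj_Fn)

lemma Loop_maps:
  assumes "pointed_sset S" "f \<in> ps_maps X Y" "pointed_sset X"
  shows "map_rename Fn Fn (mapping_space S X) (mapping_space_map S X f)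
    \<in> ps_maps (ps_rename Fn (mapping_space S X)) (ps_rename Fn (mapping_space S Y))"
  using assms by (simp add: inj_Fn map_rename_maps mapping_space_map_maps pointed_sset_mapping_space)

lemma pointed_sset_Loop:
  "pointed_sset S \<Longrightarrow> pointed_sset X \<Longrightarrow> pointed_sset (ps_rename Fn (mapping_space S X))"
  by (simp add: inj_Fn pointed_sset_rename pointed_sset_mapping_space)

lemma cat_functor_Loop:
  assumes S: "pointed_sset S"
  shows "cat_functor sSet_pt sSet_pt (Loop S)"
proof (unfold_locales, goal_cases)
  case (1 X)
  then show ?case using S by (simp add: pointed_sset_Loop)
next
  case (2 f X Y)
  then show ?case using S by (auto simp: Hom_sSet_pt pointed_sset_Loop Loop_maps)
next
  case (3 X)
  then have X: "pointed_sset X" by simp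
  have *: "ps_comp (cyl S n) (ps_id X) h = h" if "h \<in> ps_maps (cyl S n) X" for n h
    by (rule ps_maps_eqI[OF ps_comp_maps[OF pointed_sset_cyl[OF S] that ps_id_maps[OF X]] that])
      (simp add: ps_maps_cells[OF that])
  have "map_rename Fn Fn (mapping_space S X) (mapping_space_map S X (ps_id X))
    = ps_id (ps_rename Fn (mapping_space S X))"
    by (rule ps_maps_eqI[OF Loop_maps[OF S ps_id_maps[OF X] X] ps_id_maps[OF pointed_sset_Loop[OF S X]]])
      (auto simp: Loop_apply *)
  then show ?case by simp
next
  case (4 f X Y g Z)
  then obtain f' g' where f: "f = (X, f', Y)" "f' \<in> ps_maps X Y" and g: "g = (Y, g', Z)" "g' \<in> ps_maps Y Z"
    and p: "pointed_sset X" "pointed_sset Y" "pointed_sset Z"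
    by (auto simp: Hom_sSet_pt)
  note gf = ps_comp_maps[OF p(1) f(2) g(2)]
  have "map_rename Fn Fn (mapping_space S X) (mapping_space_map S X (ps_comp X g' f'))
    = ps_comp (ps_rename Fn (mapping_space S X)) (map_rename Fn Fn (mapping_space S Y) (mapping_space_map S Y g'))
       (map_rename Fn Fn (mapping_space S X) (mapping_space_map S X f'))"
    by (rule ps_maps_eqI[OF Loop_maps[OF S gf p(1)] ps_comp_maps[OF pointed_sset_Loop[OF S p(1)]
            Loop_maps[OF S f(2) p(1)] Loop_maps[OF S g(2) p(2)]]])
      (auto simp: Loop_apply ps_comp_assoc ps_comp_maps[OF pointed_sset_cyl[OF S] _ f(2)])
  then show ?case using f g by simp
qed

subsection \<open>The adjunction between suspension and loops\<close>

text \<open>The simplex of the mapping space inside \<open>susp_loop_unit\<close>, before the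
  wrapper \<open>Fn\<close>, so that it can be handled as a map out of a cylinder.\<close>

definition unit_simplex ::
  "'s psset \<Rightarrow> ('s, 'v) uobj \<Rightarrow> nat \<Rightarrow> ('s, 'v) univ \<Rightarrow> ('s, ('s, 'v) univ) map_cell" where
  "unit_simplex S X n x =
     (\<lambda>k. \<lambda>z \<in> cells (cyl S n) k.
        Sm (case z of Some (s, Some \<alpha>) \<Rightarrow> smash_class X S k (act X k n \<alpha> x) s | _ \<Rightarrow> None))"

lemma unit_simplex_apply:
  assumes "s \<in> cells S k" "\<alpha> \<in> Delta k n"
  shows "unit_simplex S X n x k (cyl_cell S n k s \<alpha>) = Sm (smash_class X S k (act X k n \<alpha> x) s)"
  using cyl_cell_cells[OF assms] by (auto simp: unit_simplex_def cyl_cell_alt)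

lemma unit_simplex_maps:
  assumes S: "pointed_sset S" and X: "pointed_sset X" and x: "x \<in> cells X n"
  shows "unit_simplex S X n x \<in> ps_maps (cyl S n) (ps_rename Sm (smash X S))"
proof (rule ps_mapsI, goal_cases)
  case (1 k z)
  then show ?case
    using x by (auto simp: unit_simplex_apply act_cells[OF X] intro!: smash_class_cells elim!: cyl_cellsE[OF _ S])
next
  case (2 m k \<theta> z)
  then show ?case
    using x by (auto simp: unit_simplex_apply act_cyl[OF S] act_cells[OF S] Delta_compose inj_Sm
        act_smash[OF X S] act_compose[OF X] elim!: cyl_cellsE[OF _ S])
next
  case (3 k)
  then show ?case
    using pt_cells[OF pointed_sset_cyl[OF S], of n k] by (simp add: unit_simplex_def)
next
  case (4 k)
  then show ?case by (simp add: unit_simplex_def)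
qed

definition unit_fun ::
  "'s psset \<Rightarrow> ('s, 'v) uobj \<Rightarrow> nat \<Rightarrow> ('s, 'v) univ \<Rightarrow> ('s, 'v) univ" where
  "unit_fun S X n = (\<lambda>x \<in> cells X n. Fn (unit_simplex S X n x))"

lemma unit_fun_apply [simp]: "x \<in> cells X n \<Longrightarrow> unit_fun S X n x = Fn (unit_simplex S X n x)"
  by (simp add: unit_fun_def)

lemma susp_loop_unit_eq:
  "susp_loop_unit S X = (X, unit_fun S X, ps_rename Fn (mapping_space S (ps_rename Sm (smash X S))))"
  by (auto simp: susp_loop_unit_def unit_simplex_def unit_fun_def)

text \<open>On a cell with second coordinate \<alpha>, acting by \<theta> before or after the unit
  gives the action of the composite of \<theta> and \<alpha> on \<open>x\<close>; this is the
  composition law \<open>act_compose\<close>.\<close>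

lemma unit_fun_maps:
  fixes X :: "('s, 'v) uobj"
  assumes S: "pointed_sset S" and X: "pointed_sset X"
  shows "unit_fun S X \<in> ps_maps X (ps_rename Fn (mapping_space S (ps_rename Sm (smash X S))))"
proof (rule ps_mapsI, goal_cases)
  case (1 n x)
  then show ?case using unit_simplex_maps[OF S X] by auto
next
  case (2 m n \<theta> x)
  note c = pointed_sset_cyl[OF S]
  have "unit_simplex S X m (act X m n \<theta> x) = ps_comp (cyl S m) (unit_simplex S X n x) (cyl_map S m n \<theta>)"
    by (rule cyl_maps_eqI[OF S unit_simplex_maps[OF S X act_cells[OF X 2]]
          ps_comp_maps[OF c cyl_map_maps[OF S 2(1)] unit_simplex_maps[OF S X 2(2)]]])
      (simp add: unit_simplex_apply cyl_cell_cells cyl_map_apply[OF S 2(1)] Delta_compose[OF _ 2(1)]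
         act_compose[OF X _ 2])
  then show ?case using 2 act_cells[OF X 2] by (simp add: inj_Fn)
next
  case (3 n)
  note Z = pointed_sset_Susp[OF S X]
  have "unit_simplex S X n (pt X n)
    = (\<lambda>k. \<lambda>z \<in> cells (cyl S n) k. pt (ps_rename Sm (smash X S)) k)"
    by (rule cyl_maps_eqI[OF S unit_simplex_maps[OF S X pt_cells[OF X]] const_maps[OF pointed_sset_cyl[OF S] Z]])
      (simp add: unit_simplex_apply cyl_cell_cells act_pt[OF X])
  then show ?case by (simp add: pt_cells[OF X])
next
  case (4 n)
  then show ?case by (simp add: unit_fun_def)
qed

definition counit_fun ::
  "'s psset \<Rightarrow> ('s, 'v) uobj \<Rightarrow> nat \<Rightarrow> ('s, 'v) univ \<Rightarrow> ('s, 'v) univ" where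
  "counit_fun S X n = (\<lambda>w \<in> cells (ps_rename Sm (smash (ps_rename Fn (mapping_space S X)) S)) n.
     (case w of
        Sm (Some (Fn h, s)) \<Rightarrow>
          h n (smash_class S (simplex_plus n) n s (Some (restrict id {..n})))
      | _ \<Rightarrow> pt X n))"

lemma susp_loop_counit_eq:
  "susp_loop_counit S X =
     (ps_rename Sm (smash (ps_rename Fn (mapping_space S X)) S), counit_fun S X, X)"
  by (auto simp: susp_loop_counit_def counit_fun_def Let_def)

text \<open>Evaluation at the identity operator is well defined on the smash product, so the formula
  may be used on every representative, including collapsed ones where \<open>counit_fun\<close>
  returns the base point by its default case.\<close>

lemma counit_fun_apply:
  assumes S: "pointed_sset S" and h: "h \<in> ps_maps (cyl S n) X" and s: "s \<in> cells S n"
  shows "counit_fun S X n (Sm (smash_class (ps_rename Fn (mapping_space S X)) S n (Fn h) s))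
    = h n (cyl_cell S n n s (restrict id {..n}))" (is "counit_fun S X n (Sm ?w) = _")
proof -
  have w: "?w \<in> cells (smash (ps_rename Fn (mapping_space S X)) S) n"
    using h s by (intro smash_class_cells) auto
  show ?thesis
  proof (cases "?w = None")
    case False
    then have "?w = Some (Fn h, s)" by (auto simp: smash_class_def split: if_splits)
    then show ?thesis using w by (simp add: counit_fun_def cyl_cell_def)
  next
    case True
    \<comment> \<open>Either the argument of \<open>h\<close> is the base point, which
      \<open>h\<close> preserves, or \<open>h\<close> is the constant map; in both cases the
      evaluation agrees with the default value.\<close>
    then consider "s = pt S n" | "h = (\<lambda>k. \<lambda>z \<in> cells (cyl S n) k. pt X k)"
      by (auto simp: smash_class_def split: if_splits)
    then have "h n (cyl_cell S n n s (restrict id {..n})) = pt X n"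
      by cases (use ps_maps_pt[OF h, of n] cyl_cell_cells[OF s Delta_id] in \<open>auto simp: cyl_cell_alt\<close>)
    then show ?thesis using w True by (simp add: counit_fun_def)
  qed
qed

lemma Susp_Loop_cellsE:
  assumes "w \<in> cells (ps_rename Sm (smash (ps_rename Fn (mapping_space S X)) S)) n"
  obtains h s where "h \<in> ps_maps (cyl S n) X" "s \<in> cells S n"
    "w = Sm (smash_class (ps_rename Fn (mapping_space S X)) S n (Fn h) s)"
  using assms by (auto elim!: smash_cellsE)

lemma counit_fun_maps:
  assumes S: "pointed_sset S" and X: "pointed_sset X"
  shows "counit_fun S X \<in> ps_maps (ps_rename Sm (smash (ps_rename Fn (mapping_space S X)) S)) X"
proof (rule ps_mapsI, goal_cases)
  case (1 n w)
  then obtain h s where "h \<in> ps_maps (cyl S n) X" "s \<in> cells S n"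
    "w = Sm (smash_class (ps_rename Fn (mapping_space S X)) S n (Fn h) s)"
    by (rule Susp_Loop_cellsE)
  then show ?case
    by (simp only: counit_fun_apply[OF S] ps_maps_cells[OF _ cyl_cell_cells[OF _ Delta_id]])
next
  case (2 m n \<theta> w)
  from 2(2) obtain h s where h: "h \<in> ps_maps (cyl S n) X" and s: "s \<in> cells S n"
    and w: "w = Sm (smash_class (ps_rename Fn (mapping_space S X)) S n (Fn h) s)"
    by (rule Susp_Loop_cellsE)
  \<comment> \<open>The restriction of \<open>h\<close> along \<theta>, evaluated at the identity of
    [m], is \<open>h\<close> evaluated at \<theta>. That cell is the restriction along \<theta> of
    the cell with the identity of [n], so simpliciality of \<open>h\<close> gives the claim.\<close>
  have \<theta>h: "ps_comp (cyl S m) h (cyl_map S m n \<theta>) \<in> ps_maps (cyl S m) X"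
    by (rule ps_comp_maps[OF pointed_sset_cyl[OF S] cyl_map_maps[OF S 2(1)] h])
  show ?case
    using 2(1) act_cells[OF S 2(1) s]
    by (simp add: w inj_Sm inj_Fn act_smash[OF pointed_sset_Loop[OF S X] S 2(1)] counit_fun_apply[OF S h s]
        counit_fun_apply[OF S \<theta>h] cyl_cell_cells Delta_id cyl_map_apply[OF S 2(1)]
        ps_maps_act[OF h 2(1), symmetric] s act_cyl[OF S 2(1)])
next
  case (3 n)
  then show ?case
    using pt_cells[OF pointed_sset_Susp[OF S pointed_sset_Loop[OF S X]], of n]
    by (simp add: counit_fun_def)
next
  case (4 n)
  then show ?case by (simp add: counit_fun_def)
qed

lemma adjunction_susp_loop:
  assumes S: "pointed_sset S"
  shows "adjunction sSet_pt sSet_pt (susp_loop S)"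
proof -
  interpret L: cat_functor sSet_pt sSet_pt "Susp S" by (rule cat_functor_Susp[OF S])
  interpret R: cat_functor sSet_pt sSet_pt "Loop S" by (rule cat_functor_Loop[OF S])
  interpret RL: cat_functor sSet_pt sSet_pt "comp_fctr (Loop S) (Susp S)"
    by (rule comp_cat_functor[OF cat_functor_Susp[OF S] cat_functor_Loop[OF S]])
  interpret LR: cat_functor sSet_pt sSet_pt "comp_fctr (Susp S) (Loop S)"
    by (rule comp_cat_functor[OF cat_functor_Loop[OF S] cat_functor_Susp[OF S]])
  interpret I: cat_functor sSet_pt sSet_pt id_fctr by (rule sSet.id_cat_functor)
  note c = pointed_sset_cyl[OF S]
  have unit: "nat_transformation sSet_pt sSet_pt id_fctr (comp_fctr (Loop S) (Susp S)) (susp_loop_unit S)"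
  proof (unfold_locales, goal_cases)
    case (1 X)
    then have X: "pointed_sset X" by simp
    show ?case
      using X unit_fun_maps[OF S X] pointed_sset_Loop[OF S pointed_sset_Susp[OF S X]]
      by (simp add: Hom_sSet_pt susp_loop_unit_eq)
  next
    case (2 f X Y)
    then obtain f' where f: "f = (X, f', Y)" "f' \<in> ps_maps X Y"
      and X: "pointed_sset X" and Y: "pointed_sset Y"
      by (auto simp: Hom_sSet_pt)
    note Sf = Susp_maps[OF S f(2) X Y]
    have *: "unit_simplex S Y n (f' n x) = ps_comp (cyl S n)
        (map_rename Sm Sm (smash X S) (smash_map X S Y S f' (ps_id S))) (unit_simplex S X n x)"
      if x: "x \<in> cells X n" for n x
      by (rule cyl_maps_eqI[OF S unit_simplex_maps[OF S Y ps_maps_cells[OF f(2) x]]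
            ps_comp_maps[OF c unit_simplex_maps[OF S X x] Sf]])
        (simp add: unit_simplex_apply cyl_cell_cells Susp_apply[OF S f(2)] act_cells[OF X] x
           ps_maps_act[OF f(2) _ x])
    have "ps_comp X (unit_fun S Y) f' = ps_comp X
        (map_rename Fn Fn (mapping_space S (ps_rename Sm (smash X S)))
          (mapping_space_map S (ps_rename Sm (smash X S))
            (map_rename Sm Sm (smash X S) (smash_map X S Y S f' (ps_id S)))))
        (unit_fun S X)"
      by (rule ps_maps_eqI[OF ps_comp_maps[OF X f(2) unit_fun_maps[OF S Y]]
            ps_comp_maps[OF X unit_fun_maps[OF S X] Loop_maps[OF S Sf pointed_sset_Susp[OF S X]]]])
        (simp add: ps_maps_cells[OF f(2)] Loop_apply[OF unit_simplex_maps[OF S X]] *)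
    then show ?case using f by (simp add: susp_loop_unit_eq)
  qed
  have counit: "nat_transformation sSet_pt sSet_pt (comp_fctr (Susp S) (Loop S)) id_fctr (susp_loop_counit S)"
  proof (unfold_locales, goal_cases)
    case (1 X)
    then have X: "pointed_sset X" by simp
    show ?case
      using X counit_fun_maps[OF S X] pointed_sset_Susp[OF S pointed_sset_Loop[OF S X]]
      by (simp add: Hom_sSet_pt susp_loop_counit_eq)
  next
    case (2 f X Y)
    then obtain f' where f: "f = (X, f', Y)" "f' \<in> ps_maps X Y"
      and X: "pointed_sset X" and Y: "pointed_sset Y"
      by (auto simp: Hom_sSet_pt)
    let ?LX = "ps_rename Fn (mapping_space S X)" and ?LY = "ps_rename Fn (mapping_space S Y)"
    let ?Lf = "map_rename Fn Fn (mapping_space S X) (mapping_space_map S X f')"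
    note Lf = Loop_maps[OF S f(2) X]
    note LX = pointed_sset_Loop[OF S X] and LY = pointed_sset_Loop[OF S Y]
    note W = pointed_sset_Susp[OF S LX]
    have "ps_comp (ps_rename Sm (smash ?LX S)) (counit_fun S Y)
        (map_rename Sm Sm (smash ?LX S) (smash_map ?LX S ?LY S ?Lf (ps_id S)))
      = ps_comp (ps_rename Sm (smash ?LX S)) f' (counit_fun S X)"
    proof (rule ps_maps_eqI[OF ps_comp_maps[OF W Susp_maps[OF S Lf LX LY] counit_fun_maps[OF S Y]]
          ps_comp_maps[OF W counit_fun_maps[OF S X] f(2)]])
      fix n w assume w: "w \<in> cells (ps_rename Sm (smash ?LX S)) n"
      then obtain h s where h: "h \<in> ps_maps (cyl S n) X" and s: "s \<in> cells S n"
        and w': "w = Sm (smash_class ?LX S n (Fn h) s)"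
        by (rule Susp_Loop_cellsE)
      have Fh: "Fn h \<in> cells ?LX n" using h by simp
      show "ps_comp (ps_rename Sm (smash ?LX S)) (counit_fun S Y)
          (map_rename Sm Sm (smash ?LX S) (smash_map ?LX S ?LY S ?Lf (ps_id S))) n w
        = ps_comp (ps_rename Sm (smash ?LX S)) f' (counit_fun S X) n w"
        by (simp only: ps_comp_apply[OF w])
          (simp only: w' Susp_apply[OF S Lf Fh s] Loop_apply[OF h]
            counit_fun_apply[OF S h s] counit_fun_apply[OF S ps_comp_maps[OF c h f(2)] s]
            ps_comp_apply[OF cyl_cell_cells[OF s Delta_id]])
    qed
    then show ?case using f by (simp add: susp_loop_counit_eq)
  qed
  \<comment> \<open>Unit followed by evaluation restricts \<open>x\<close> along the identity of
    [n], which is \<open>x\<close> again.\<close>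
  have tri_left: "Comp sSet_pt (susp_loop_counit S (on_ob (Susp S) X)) (on_arr (Susp S) (susp_loop_unit S X))
      = Id sSet_pt (on_ob (Susp S) X)" if "X \<in> Ob sSet_pt" for X
  proof -
    have X: "pointed_sset X" using that by simp
    let ?SX = "ps_rename Sm (smash X S)"
    let ?LSX = "ps_rename Fn (mapping_space S ?SX)"
    note SX = pointed_sset_Susp[OF S X] and u = unit_fun_maps[OF S X]
    note LSX = pointed_sset_Loop[OF S SX]
    have "ps_comp ?SX (counit_fun S ?SX) (map_rename Sm Sm (smash X S) (smash_map X S ?LSX S (unit_fun S X) (ps_id S)))
      = ps_id ?SX"
    proof (rule ps_maps_eqI[OF ps_comp_maps[OF SX Susp_maps[OF S u X LSX] counit_fun_maps[OF S SX]] ps_id_maps[OF SX]])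
      fix n w assume w: "w \<in> cells ?SX n"
      then obtain x s where x: "x \<in> cells X n" and s: "s \<in> cells S n"
        and w': "w = Sm (smash_class X S n x s)"
        by (auto elim!: smash_cellsE)
      show "ps_comp ?SX (counit_fun S ?SX)
          (map_rename Sm Sm (smash X S) (smash_map X S ?LSX S (unit_fun S X) (ps_id S))) n w = ps_id ?SX n w"
        by (simp only: ps_comp_apply[OF w] ps_id_apply[OF w])
          (simp only: w' Susp_apply[OF S u x s] unit_fun_apply[OF x] act_id[OF X x]
            counit_fun_apply[OF S unit_simplex_maps[OF S X x] s] unit_simplex_apply[OF s Delta_id])
    qed
    then show ?thesis by (simp add: susp_loop_counit_eq susp_loop_unit_eq)
  qed
  have tri_right: "Comp sSet_pt (on_arr (Loop S) (susp_loop_counit S X)) (susp_loop_unit S (on_ob (Loop S) X))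
      = Id sSet_pt (on_ob (Loop S) X)" if "X \<in> Ob sSet_pt" for X
  proof -
    have X: "pointed_sset X" using that by simp
    let ?LX = "ps_rename Fn (mapping_space S X)"
    let ?SLX = "ps_rename Sm (smash ?LX S)"
    note LX = pointed_sset_Loop[OF S X] and e = counit_fun_maps[OF S X]
    note SLX = pointed_sset_Susp[OF S LX]
    \<comment> \<open>The Yoneda argument: the value of \<open>h\<close> at a cell with second
      coordinate \<alpha> is the value of the restriction of \<open>h\<close> along \<alpha> at the
      identity of [k], so evaluations at identities recover \<open>h\<close>.\<close>
    have *: "ps_comp (cyl S n) (counit_fun S X) (unit_simplex S ?LX n (Fn h)) = h"
      if h: "h \<in> ps_maps (cyl S n) X" for n h
    proof -
      have Fh: "Fn h \<in> cells ?LX n" using h by simp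
      show ?thesis
      proof (rule cyl_maps_eqI[OF S ps_comp_maps[OF c unit_simplex_maps[OF S LX Fh] e] h])
        fix k s \<alpha> assume s: "s \<in> cells S k" and \<alpha>: "\<alpha> \<in> Delta k n"
        note \<alpha>h = ps_comp_maps[OF c cyl_map_maps[OF S \<alpha>] h]
        show "ps_comp (cyl S n) (counit_fun S X) (unit_simplex S ?LX n (Fn h)) k (cyl_cell S n k s \<alpha>)
          = h k (cyl_cell S n k s \<alpha>)"
          using s \<alpha>
          by (simp add: cyl_cell_cells unit_simplex_apply inj_Fn counit_fun_apply[OF S \<alpha>h s] Delta_id
              cyl_map_apply[OF S \<alpha>])
      qed
    qed
    have "ps_comp ?LX (map_rename Fn Fn (mapping_space S ?SLX) (mapping_space_map S ?SLX (counit_fun S X)))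
        (unit_fun S ?LX) = ps_id ?LX"
      by (rule ps_maps_eqI[OF ps_comp_maps[OF LX unit_fun_maps[OF S LX] Loop_maps[OF S e SLX]] ps_id_maps[OF LX]])
        (auto simp: Loop_apply[OF unit_simplex_maps[OF S LX]] *)
    then show ?thesis by (simp add: susp_loop_counit_eq susp_loop_unit_eq)
  qed
  show ?thesis
    by (simp add: adjunction_def susp_loop_def cat_functor_Susp[OF S] cat_functor_Loop[OF S] unit counit
        tri_left tri_right del: Susp_simps Loop_simps sSet_pt_simps)
qed

subsection \<open>Equalizers and isomorphisms of pointed simplicial sets\<close>

text \<open>The degreewise preimages assemble to a pointed simplicial map because their
  compatibility can be tested after the injective \<open>f\<close>. It produces both inverse maps
  and factorizations through equalizers.\<close>

lemma ps_maps_factor: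
  assumes W: "pointed_sset W" and X: "pointed_sset X" and f: "f \<in> ps_maps X Y" and h: "h \<in> ps_maps W Y"
    and inj: "\<And>n. inj_on (f n) (cells X n)"
    and im: "\<And>n w. w \<in> cells W n \<Longrightarrow> h n w \<in> f n ` cells X n"
  obtains u where "u \<in> ps_maps W X" "ps_comp W f u = h"
proof -
  define u where "u n = (\<lambda>w \<in> cells W n. inv_into (cells X n) (f n) (h n w))" for n
  have u: "u n w \<in> cells X n" "f n (u n w) = h n w" if "w \<in> cells W n" for n w
    using that by (simp_all add: u_def inv_into_into[OF im] f_inv_into_f[OF im])
  have "u \<in> ps_maps W X"
  proof (rule ps_mapsI, goal_cases)
    case (2 m n \<theta> w)
    show ?case
      by (rule inj_onD[OF inj[of m]])
        (simp_all add: u 2 act_cells[OF W 2] act_cells[OF X 2(1)] ps_maps_act[OF f 2(1)] ps_maps_act[OF h 2])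
  next
    case (3 n)
    show ?case
      by (rule inj_onD[OF inj[of n]])
        (simp_all add: u pt_cells[OF W] pt_cells[OF X] ps_maps_pt[OF f] ps_maps_pt[OF h])
  next
    case 4
    show ?case by (simp add: u_def)
  qed (rule u)
  moreover from this have "ps_comp W f u = h"
    by (rule ps_maps_eqI[OF ps_comp_maps[OF W _ f] h]) (simp add: u)
  ultimately show ?thesis using that by blast
qed

text \<open>For the converse, the identity of \<open>Y\<close> factors through the bijective
  \<open>f\<close>; the factor is a right inverse, and injectivity makes it a left inverse
  too.\<close>

lemma is_iso_sSet_pt_iff:
  assumes X: "pointed_sset X" and Y: "pointed_sset Y" and f: "f \<in> ps_maps X Y"
  shows "is_iso sSet_pt (X, f, Y) \<longleftrightarrow> (\<forall>n. bij_betw (f n) (cells X n) (cells Y n))"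
proof -
  have fH: "(X, f, Y) \<in> Hom sSet_pt X Y" using assms by (simp add: Hom_sSet_pt)
  have cancel: "f n (g n y) = y" if "ps_comp Y f g = ps_id Y" "y \<in> cells Y n"
    for f :: "nat \<Rightarrow> 'a \<Rightarrow> 'a" and g n y and Y :: "'a psset"
    using that by (metis ps_comp_apply ps_id_apply)
  show ?thesis
  proof
    assume "is_iso sSet_pt (X, f, Y)"
    obtain g' where g': "g' \<in> Hom sSet_pt Y X" "Comp sSet_pt g' (X, f, Y) = Id sSet_pt X"
      "Comp sSet_pt (X, f, Y) g' = Id sSet_pt Y"
      using is_isoE[OF \<open>is_iso sSet_pt (X, f, Y)\<close> fH] .
    then obtain g where g: "g \<in> ps_maps Y X" "ps_comp X g f = ps_id X" "ps_comp Y f g = ps_id Y"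
      by (auto simp: Hom_sSet_pt)
    show "\<forall>n. bij_betw (f n) (cells X n) (cells Y n)"
    proof
      show "bij_betw (f n) (cells X n) (cells Y n)" for n
        using ps_maps_cells[OF f] ps_maps_cells[OF g(1)] cancel[OF g(2)] cancel[OF g(3)]
        by (intro bij_betw_byWitness[of _ "g n"]) auto
    qed
  next
    assume bij: "\<forall>n. bij_betw (f n) (cells X n) (cells Y n)"
    then have inj: "inj_on (f n) (cells X n)" and im: "f n ` cells X n = cells Y n" for n
      by (auto simp: bij_betw_def)
    obtain g where g: "g \<in> ps_maps Y X" "ps_comp Y f g = ps_id Y"
      by (rule ps_maps_factor[OF Y X f ps_id_maps[OF Y] inj]) (auto simp: im)
    have "g n (f n x) = x" if "x \<in> cells X n" for n x
      using that cancel[OF g(2)]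
      by - (rule inj_onD[OF inj[of n]], simp_all add: ps_maps_cells[OF f] ps_maps_cells[OF g(1)])
    then have "ps_comp X g f = ps_id X"
      by (intro ps_maps_eqI[OF ps_comp_maps[OF X f g(1)] ps_id_maps[OF X]]) simp
    then show "is_iso sSet_pt (X, f, Y)"
      using g X Y by (intro is_isoI[OF fH, of "(Y, g, X)"]) (simp_all add: Hom_sSet_pt)
  qed
qed

text \<open>The concrete form of an equalizer, which can be followed through a smash product one
  degree at a time, whereas the universal property gives no hold on a left adjoint. Asking for a
  bijection onto the solution set leaves the representation of the subobject free, so the notion can
  be iterated.\<close>

definition levelwise_equalizer :: "'a psmor \<Rightarrow> 'a psmor \<Rightarrow> 'a psmor \<Rightarrow> bool" where
  "levelwise_equalizer e f g \<longleftrightarrow>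
     (\<exists>E X Y e' f' g'. e = (E, e', X) \<and> f = (X, f', Y) \<and> g = (X, g', Y) \<and>
        pointed_sset E \<and> pointed_sset X \<and> pointed_sset Y \<and>
        e' \<in> ps_maps E X \<and> f' \<in> ps_maps X Y \<and> g' \<in> ps_maps X Y \<and>
        (\<forall>n. bij_betw (e' n) (cells E n) {x \<in> cells X n. f' n x = g' n x}))"

lemma levelwise_equalizer_imp_equalizer:
  assumes "levelwise_equalizer e f g"
  shows "equalizer sSet_pt e f g"
proof -
  obtain E X Y e' f' g' where efg: "e = (E, e', X)" "f = (X, f', Y)" "g = (X, g', Y)"
    and p: "pointed_sset E" "pointed_sset X" "pointed_sset Y"
    and m: "e' \<in> ps_maps E X" "f' \<in> ps_maps X Y" "g' \<in> ps_maps X Y"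
    and bij: "\<And>n. bij_betw (e' n) (cells E n) {x \<in> cells X n. f' n x = g' n x}"
    using assms unfolding levelwise_equalizer_def by blast
  have inj: "inj_on (e' n) (cells E n)" and im: "e' n ` cells E n = {x \<in> cells X n. f' n x = g' n x}" for n
    using bij[of n] by (auto simp: bij_betw_def)
  show ?thesis
  proof (rule equalizerI[of _ _ E X _ Y], goal_cases)
    case 4
    have "ps_comp E f' e' = ps_comp E g' e'"
      by (rule ps_maps_eqI[OF ps_comp_maps[OF p(1) m(1,2)] ps_comp_maps[OF p(1) m(1,3)]])
        (use im in auto)
    then show ?case by (simp add: efg)
  next
    case (5 W h)
    then obtain h' where h: "h = (W, h', X)" "h' \<in> ps_maps W X" and W: "pointed_sset W"
      by (auto simp: Hom_sSet_pt)
    have eq: "ps_comp W f' h' = ps_comp W g' h'" using 5(2) by (simp add: h efg)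
    have "f' n (h' n w) = g' n (h' n w)" if "w \<in> cells W n" for n w
      using ps_comp_apply[OF that, of f' h'] ps_comp_apply[OF that, of g' h'] eq by simp
    then obtain u where "u \<in> ps_maps W E" "ps_comp W e' u = h'"
      using ps_maps_factor[OF W p(1) m(1) h(2) inj] ps_maps_cells[OF h(2)] unfolding im by blast
    then show ?case
      using W p by (intro exI[of _ "(W, u, E)"]) (simp add: Hom_sSet_pt h efg)
  next
    case (6 W u v)
    then obtain u' v' where u: "u = (W, u', E)" "u' \<in> ps_maps W E" and v: "v = (W, v', E)" "v' \<in> ps_maps W E"
      by (auto simp: Hom_sSet_pt)
    have eq: "ps_comp W e' u' = ps_comp W e' v'" using 6(3) by (simp add: u v efg)
    have "u' = v'"
    proof (rule ps_maps_eqI[OF u(2) v(2)])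
      fix n w assume w: "w \<in> cells W n"
      then show "u' n w = v' n w"
        using ps_comp_apply[OF w, of e' u'] ps_comp_apply[OF w, of e' v'] eq
        by - (rule inj_onD[OF inj[of n]], simp_all add: ps_maps_cells[OF u(2)] ps_maps_cells[OF v(2)])
    qed
    then show ?case by (simp add: u v)
  qed (use p m in \<open>simp_all add: efg Hom_sSet_pt\<close>)
qed

lemma levelwise_equalizer_ps_equalizer:
  assumes "f \<in> Hom sSet_pt X Y" "g \<in> Hom sSet_pt X Y"
  shows "levelwise_equalizer (ps_equalizer f g) f g"
proof -
  obtain f' g' where f: "f = (X, f', Y)" "f' \<in> ps_maps X Y" and g: "g = (X, g', Y)" "g' \<in> ps_maps X Y"
    and X: "pointed_sset X" and Y: "pointed_sset Y"
    using assms by (auto simp: Hom_sSet_pt)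
  define E where "E = X\<lparr>cells := \<lambda>n. {x \<in> cells X n. f' n x = g' n x}\<rparr>"
  have E: "pointed_sset E"
    by (rule pointed_ssetI)
      (auto simp: E_def act_cells[OF X] act_id[OF X] act_compose[OF X] act_pt[OF X] pt_cells[OF X]
        ps_maps_act[OF f(2)] ps_maps_act[OF g(2)] ps_maps_pt[OF f(2)] ps_maps_pt[OF g(2)])
  have "ps_id E \<in> ps_maps E X"
    by (rule ps_mapsI) (use act_cells[OF E] pt_cells[OF E] in \<open>auto simp: E_def ps_id_def\<close>)
  moreover have "bij_betw (ps_id E n) (cells E n) {x \<in> cells X n. f' n x = g' n x}" for n
    by (auto simp: bij_betw_def inj_on_def E_def ps_id_def)
  ultimately show ?thesis
    using X Y E f g unfolding levelwise_equalizer_def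
    by (intro exI[of _ E] exI[of _ X] exI[of _ Y] exI[of _ "ps_id E"] exI[of _ f'] exI[of _ g'])
      (simp add: ps_equalizer_def E_def Let_def)
qed

text \<open>For a fixed simplex \<open>s\<close> of S other than the base point, the classes with
  second coordinate \<open>s\<close> form a copy of the simplices of X, on which the equation is the
  original one; over the base point of S everything is collapsed.\<close>

lemma levelwise_equalizer_Susp:
  assumes S: "pointed_sset S" and "levelwise_equalizer e f g"
  shows "levelwise_equalizer (on_arr (Susp S) e) (on_arr (Susp S) f) (on_arr (Susp S) g)"
proof -
  obtain E X Y e' f' g' where efg: "e = (E, e', X)" "f = (X, f', Y)" "g = (X, g', Y)"
    and p: "pointed_sset E" "pointed_sset X" "pointed_sset Y"
    and m: "e' \<in> ps_maps E X" "f' \<in> ps_maps X Y" "g' \<in> ps_maps X Y"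
    and bij: "\<And>n. bij_betw (e' n) (cells E n) {x \<in> cells X n. f' n x = g' n x}"
    using assms(2) unfolding levelwise_equalizer_def by blast
  have inj: "inj_on (e' n) (cells E n)" and im: "e' n ` cells E n = {x \<in> cells X n. f' n x = g' n x}" for n
    using bij[of n] by (auto simp: bij_betw_def)
  let ?e = "map_rename Sm Sm (smash E S) (smash_map E S X S e' (ps_id S))"
    and ?f = "map_rename Sm Sm (smash X S) (smash_map X S Y S f' (ps_id S))"
    and ?g = "map_rename Sm Sm (smash X S) (smash_map X S Y S g' (ps_id S))"
  \<comment> \<open>Injectivity prevents \<open>e'\<close> from sending a further simplex to the
    base point, so no class of E and S becomes collapsed only after applying
    \<open>e'\<close>.\<close>
  have e_pt: "e' n x = pt X n \<longleftrightarrow> x = pt E n" if "x \<in> cells E n" for n x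
    using inj_onD[OF inj _ that pt_cells[OF p(1)]] ps_maps_pt[OF m(1)] by auto
  have "bij_betw (?e n) (cells (ps_rename Sm (smash E S)) n)
      {z \<in> cells (ps_rename Sm (smash X S)) n. ?f n z = ?g n z}" for n
    unfolding bij_betw_def
  proof (intro conjI inj_onI equalityI subsetI)
    fix z w assume "z \<in> cells (ps_rename Sm (smash E S)) n" "w \<in> cells (ps_rename Sm (smash E S)) n"
      and eq: "?e n z = ?e n w"
    then obtain x s y t where x: "x \<in> cells E n" "s \<in> cells S n" "z = Sm (smash_class E S n x s)"
      and y: "y \<in> cells E n" "t \<in> cells S n" "w = Sm (smash_class E S n y t)"
      by (auto elim!: smash_cellsE)
    have "smash_class X S n (e' n x) s = smash_class X S n (e' n y) t"
      using eq by (simp add: x(3) y(3) Susp_apply[OF S m(1) x(1,2)] Susp_apply[OF S m(1) y(1,2)]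
          del: map_rename_apply)
    then show "z = w"
      using inj_onD[OF inj _ x(1) y(1)] by (auto simp: x(3) y(3) smash_class_eq_iff e_pt x(1) y(1))
  next
    fix z assume "z \<in> ?e n ` cells (ps_rename Sm (smash E S)) n"
    then obtain x s where x: "x \<in> cells E n" "s \<in> cells S n"
      and "z = ?e n (Sm (smash_class E S n x s))"
      by (auto elim!: smash_cellsE simp del: map_rename_apply)
    then have z: "z = Sm (smash_class X S n (e' n x) s)"
      by (simp add: Susp_apply[OF S m(1)] del: map_rename_apply)
    have "e' n x \<in> cells X n" "f' n (e' n x) = g' n (e' n x)" using im x by auto
    then show "z \<in> {z \<in> cells (ps_rename Sm (smash X S)) n. ?f n z = ?g n z}"
      using x by (simp add: z Susp_apply[OF S m(2)] Susp_apply[OF S m(3)] smash_class_cells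
          del: map_rename_apply)
  next
    fix z assume "z \<in> {z \<in> cells (ps_rename Sm (smash X S)) n. ?f n z = ?g n z}"
    then obtain x s where x: "x \<in> cells X n" and s: "s \<in> cells S n" and z: "z = Sm (smash_class X S n x s)"
      and eq: "?f n z = ?g n z"
      by (auto elim!: smash_cellsE)
    have eq': "smash_class Y S n (f' n x) s = smash_class Y S n (g' n x) s"
      using eq by (simp add: z Susp_apply[OF S m(2) x s] Susp_apply[OF S m(3) x s] del: map_rename_apply)
    \<comment> \<open>If \<open>s\<close> is the base point, the class is collapsed and the base
      point of E represents it. Otherwise equal classes force equal first coordinates: even when
      both classes are collapsed, both coordinates are the base point of Y.\<close>
    obtain a where a: "a \<in> cells E n" "smash_class X S n x s = smash_class X S n (e' n a) s"
    proof (cases "s = pt S n")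
      case True
      then show ?thesis using that[OF pt_cells[OF p(1)]] by simp
    next
      case False
      then have "f' n x = g' n x" using eq' by (auto simp: smash_class_eq_iff)
      then have "x \<in> e' n ` cells E n" using x im by simp
      then show ?thesis using that by auto
    qed
    then have "z = ?e n (Sm (smash_class E S n a s))"
      by (simp add: z Susp_apply[OF S m(1) a(1) s] del: map_rename_apply)
    then show "z \<in> ?e n ` cells (ps_rename Sm (smash E S)) n"
      using a(1) s smash_class_cells[of a E n s S] by auto
  qed
  then show ?thesis
    using Susp_maps[OF S m(1) p(1,2)] Susp_maps[OF S m(2) p(2,3)] Susp_maps[OF S m(3) p(2,3)]
      pointed_sset_Susp[OF S p(1)] pointed_sset_Susp[OF S p(2)] pointed_sset_Susp[OF S p(3)]
    unfolding levelwise_equalizer_def efg Susp_simps by blast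
qed

section \<open>Retracts between degrees and reflection of isomorphisms\<close>

lemma Delta_retract:
  assumes "k \<le> n"
  obtains \<sigma> \<iota> where "\<sigma> \<in> Delta n k" "\<iota> \<in> Delta k n" "compose {..k} \<sigma> \<iota> = restrict id {..k}"
proof
  show "(\<lambda>i\<in>{..n}. min i k) \<in> Delta n k" by (rule DeltaI) auto
  show "restrict id {..k} \<in> Delta k n" by (rule DeltaI) (use assms in auto)
  show "compose {..k} (\<lambda>i\<in>{..n}. min i k) (restrict id {..k}) = restrict id {..k}"
    using assms by (auto simp: compose_def fun_eq_iff restrict_def)
qed

text \<open>Contravariance turns the retraction of [n] onto [k] into one of simplices in degree n
  onto simplices in degree k, natural in X. Bijectivity of a simplicial map in degree n therefore
  descends to degree k.\<close>

lemma act_retract: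
  assumes "pointed_sset X" "\<sigma> \<in> Delta n k" "\<iota> \<in> Delta k n" "compose {..k} \<sigma> \<iota> = restrict id {..k}"
    and "x \<in> cells X k"
  shows "act X k n \<iota> (act X n k \<sigma> x) = x"
  using assms by (metis act_compose act_id)

text \<open>In the degrees in which \<open>S\<close> has no simplex besides the base point, \<open>- \<and> S\<close> forgets
  everything; there the map is recovered as a retract of a component of higher degree.\<close>

lemma Susp_reflects_iso:
  assumes S: "pointed_sset S" and s0: "s0 \<in> cells S n0" "s0 \<noteq> pt S n0"
    and f: "f \<in> Arr sSet_pt" and iso: "is_iso sSet_pt (on_arr (Susp S) f)"
  shows "is_iso sSet_pt f"
proof -
  obtain X f' Y where f': "f = (X, f', Y)" "f' \<in> ps_maps X Y" and X: "pointed_sset X" and Y: "pointed_sset Y"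
    using f by (auto simp: sSet_pt_def)
  let ?f = "map_rename Sm Sm (smash X S) (smash_map X S Y S f' (ps_id S))"
  have bij: "bij_betw (?f n) (cells (ps_rename Sm (smash X S)) n) (cells (ps_rename Sm (smash Y S)) n)" for n
    using iso is_iso_sSet_pt_iff[OF pointed_sset_Susp[OF S X] pointed_sset_Susp[OF S Y] Susp_maps[OF S f'(2) X Y]]
    by (simp add: f' del: ps_rename_simps)
  \<comment> \<open>Pairing with a simplex \<open>s\<close> that is not the base point embeds the
    simplices of X and of Y into the suspensions, so bijectivity can be read off there.\<close>
  have nondegenerate: "bij_betw (f' n) (cells X n) (cells Y n)"
    if s: "s \<in> cells S n" "s \<noteq> pt S n" for n s
    unfolding bij_betw_def
  proof (intro conjI inj_onI equalityI subsetI)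
    fix x y assume x: "x \<in> cells X n" and y: "y \<in> cells X n" and eq: "f' n x = f' n y"
    have "?f n (Sm (smash_class X S n x s)) = ?f n (Sm (smash_class X S n y s))"
      by (simp add: Susp_apply[OF S f'(2) x s(1)] Susp_apply[OF S f'(2) y s(1)] eq del: map_rename_apply)
    then have "Sm (smash_class X S n x s) = Sm (smash_class X S n y s)"
      by (rule inj_onD[OF bij_betw_imp_inj_on[OF bij[of n]]])
        (simp_all add: smash_class_cells x y s(1))
    then show "x = y" using s by (auto simp: smash_class_eq_iff)
  next
    fix y assume "y \<in> f' n ` cells X n"
    then show "y \<in> cells Y n" using ps_maps_cells[OF f'(2)] by auto
  next
    fix y assume y: "y \<in> cells Y n"
    have "Sm (smash_class Y S n y s) \<in> cells (ps_rename Sm (smash Y S)) n"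
      using smash_class_cells[OF y s(1)] by simp
    then have "Sm (smash_class Y S n y s) \<in> ?f n ` cells (ps_rename Sm (smash X S)) n"
      unfolding bij_betw_imp_surj_on[OF bij[of n]] .
    then obtain x t where x: "x \<in> cells X n" "t \<in> cells S n"
      and "Sm (smash_class Y S n y s) = ?f n (Sm (smash_class X S n x t))"
      by (auto elim!: smash_cellsE simp del: map_rename_apply)
    then have eq: "smash_class Y S n y s = smash_class Y S n (f' n x) t"
      by (simp add: Susp_apply[OF S f'(2)] del: map_rename_apply)
    \<comment> \<open>As \<open>s\<close> is not the base point, the class of \<open>y\<close> and
      \<open>s\<close> can be collapsed only through \<open>y\<close>; then \<open>x\<close> and
      \<open>t\<close> carry no information and the base point of X is used. Otherwise the two
      representatives coincide, so \<open>y\<close> is the image of \<open>x\<close>.\<close>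
    show "y \<in> f' n ` cells X n"
    proof (cases "y = pt Y n")
      case True
      then have "y = f' n (pt X n)" by (simp add: ps_maps_pt[OF f'(2)])
      then show ?thesis using pt_cells[OF X] by (rule image_eqI)
    next
      case False
      then have "y = f' n x" using eq s by (auto simp: smash_class_eq_iff)
      then show ?thesis using x by simp
    qed
  qed
  have "bij_betw (f' k) (cells X k) (cells Y k)" for k
  proof -
    \<comment> \<open>Large enough to receive \<open>s0\<close> from degree \<open>n0\<close> and to
      have degree \<open>k\<close> as a retract.\<close>
    define n where "n = max k n0"
    obtain \<sigma>0 \<iota>0 where r0: "\<sigma>0 \<in> Delta n n0" "\<iota>0 \<in> Delta n0 n" "compose {..n0} \<sigma>0 \<iota>0 = restrict id {..n0}"
      by (rule Delta_retract[of n0 n]) (simp_all add: n_def)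
    \<comment> \<open>Restriction along \<open>\<iota>0\<close> recovers \<open>s0\<close>; it would
      give the base point if the degenerate simplex were the base point.\<close>
    have "act S n n0 \<sigma>0 s0 \<noteq> pt S n"
      using act_retract[OF S r0 s0(1)] act_pt[OF S r0(2)] s0(2) by metis
    then have bij: "bij_betw (f' n) (cells X n) (cells Y n)"
      by (rule nondegenerate[OF act_cells[OF S r0(1) s0(1)]])
    obtain \<sigma> \<iota> where r: "\<sigma> \<in> Delta n k" "\<iota> \<in> Delta k n" "compose {..k} \<sigma> \<iota> = restrict id {..k}"
      by (rule Delta_retract[of k n]) (simp_all add: n_def)
    note rX = act_retract[OF X r] and rY = act_retract[OF Y r]
    show ?thesis
      unfolding bij_betw_def
    proof (intro conjI inj_onI equalityI subsetI)
      fix x y assume x: "x \<in> cells X k" and y: "y \<in> cells X k" and eq: "f' k x = f' k y"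
      \<comment> \<open>The equation is carried up to degree \<open>n\<close>, where
        \<open>f'\<close> is injective, and comes down again by the retraction.\<close>
      have "act X n k \<sigma> x = act X n k \<sigma> y"
        by (rule inj_onD[OF bij_betw_imp_inj_on[OF bij]])
          (simp_all add: ps_maps_act[OF f'(2) r(1)] x y eq act_cells[OF X r(1)])
      then show "x = y" using rX[OF x] rX[OF y] by metis
    next
      fix y assume "y \<in> f' k ` cells X k"
      then show "y \<in> cells Y k" using ps_maps_cells[OF f'(2)] by auto
    next
      fix y assume y: "y \<in> cells Y k"
      then have "act Y n k \<sigma> y \<in> f' n ` cells X n"
        using bij_betw_imp_surj_on[OF bij] act_cells[OF Y r(1)] by simp
      then obtain x where x: "x \<in> cells X n" "act Y n k \<sigma> y = f' n x" by auto
      then have "y = f' k (act X k n \<iota> x)"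
        using rY[OF y] ps_maps_act[OF f'(2) r(2) x(1)] by metis
      then show "y \<in> f' k ` cells X k" using act_cells[OF X r(2) x(1)] by blast
    qed
  qed
  then show ?thesis using is_iso_sSet_pt_iff[OF X Y f'(2)] by (simp add: f'(1))
qed

section \<open>Contractible realizations and nontriviality of circle models\<close>

lemma contractible_quotient_to_point:
  assumes c: "topspace T // E \<subseteq> {c}"
  shows "contractible_space (quotient_topology T E)"
proof -
  let ?Q = "topspace T // E"
  let ?op = "\<lambda>U. U \<subseteq> ?Q \<and> openin T (\<Union>U)"
  have sub: "U = {} \<or> U = {c}" if "U \<subseteq> ?Q" for U
    by (rule subset_singletonD[OF subset_trans[OF that c]])
  have ist: "istopology ?op"
    unfolding istopology_def
  proof (rule conjI; intro allI impI)
    fix U V assume UV: "?op U" "?op V"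
    \<comment> \<open>For an arbitrary relation \<open>E\<close>, classes may overlap, and the union
      of an intersection of families need not be the intersection of their unions. With at most one
      class the intersection is empty or one of the given sets.\<close>
    have "U \<inter> V = {} \<or> U \<inter> V = U"
      using sub[OF conjunct1[OF UV(1)]] sub[OF conjunct1[OF UV(2)]] by fast
    then show "?op (U \<inter> V)"
      by (rule disjE) (simp_all add: UV)
  next
    fix \<U> assume \<U>: "\<forall>U\<in>\<U>. ?op U"
    have "\<Union>\<U> \<subseteq> ?Q" using \<U> by (intro Union_least) simp
    moreover have "openin T (\<Union>(Union ` \<U>))" using \<U> by (intro openin_Union) auto
    moreover have "\<Union>(\<Union>\<U>) = \<Union>(Union ` \<U>)" by blast
    ultimately show "?op (\<Union>\<U>)" by simp
  qed
  have "openin (quotient_topology T E) = ?op"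
    unfolding quotient_topology_def by (rule topology_inverse'[OF ist])
  \<comment> \<open>An inclusion suffices, since the empty space and a one-point space are both
    contractible.\<close>
  then have "topspace (quotient_topology T E) \<subseteq> ?Q"
    by (metis openin_topspace)
  then have "topspace (quotient_topology T E) \<subseteq> {c}"
    using c by (rule subset_trans)
  then show ?thesis by (rule contractible_space_subset_singleton)
qed

text \<open>Every point lies over a base simplex, which is the restriction of the base vertex along
  the map from [n] to [0]; one gluing step therefore identifies it with the unique point over that
  vertex.\<close>

lemma realization_of_point:
  assumes S: "pointed_sset S" and trivial: "\<And>n s. s \<in> cells S n \<Longrightarrow> s = pt S n"
  shows "contractible_space (realization S)"
proof -
  define R where "R = (realization_step S \<union> (realization_step S)\<inverse>)\<^sup>*"
  \<comment> \<open>The only point of the standard 0-simplex.\<close>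
  define v :: "nat \<Rightarrow> real" where "v = (\<lambda>j. if j = 0 then 1 else 0)"
  have "equiv UNIV R"
    unfolding R_def by (intro equivI refl_rtrancl trans_rtrancl sym_rtrancl sym_Un_converse) auto
  have "(p, ((0, pt S 0), v)) \<in> R" if "p \<in> topspace (realization_space S)" for p
  proof -
    obtain n x t where nxt: "p = ((n, x), t)" by (metis prod.collapse)
    then have x: "x \<in> cells S n" and t: "t \<in> standard_simplex n"
      using that by (simp_all add: realization_space_def)
    have p: "p = ((n, pt S n), t)" using nxt trivial[OF x] by simp
    define \<theta> :: "nat \<Rightarrow> nat" where "\<theta> = (\<lambda>i\<in>{..n}. 0)"
    have \<theta>: "\<theta> \<in> Delta n 0" unfolding \<theta>_def by (rule Delta_const)
    \<comment> \<open>All barycentric coordinates are added up at the vertex 0, and their sum is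
      1.\<close>
    have "simplex_pushforward n \<theta> t = v"
    proof
      fix j
      have "{i. i \<le> n \<and> \<theta> i = j} = (if j = 0 then {..n} else {})" by (auto simp: \<theta>_def)
      then show "simplex_pushforward n \<theta> t j = v j"
        using t by (simp add: simplex_pushforward_def v_def standard_simplex_def)
    qed
    then have "p = ((n, act S n 0 \<theta> (pt S 0)), t)" "((0, pt S 0), v) = ((0, pt S 0), simplex_pushforward n \<theta> t)"
      by (simp_all add: p act_pt[OF S \<theta>])
    then have "(p, ((0, pt S 0), v)) \<in> realization_step S"
      unfolding realization_step_def using \<theta> t pt_cells[OF S, of 0] by blast
    then show ?thesis by (auto simp: R_def)
  qed
  then have "R `` {p} = R `` {((0, pt S 0), v)}" if "p \<in> topspace (realization_space S)" for p
    using equiv_class_eq[OF \<open>equiv UNIV R\<close>] that by simp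
  then have "topspace (realization_space S) // R \<subseteq> {R `` {((0, pt S 0), v)}}"
    by (auto simp: quotient_def)
  then show ?thesis
    unfolding realization_def R_def by (rule contractible_quotient_to_point)
qed

text \<open>Contractibility is invariant under homotopy equivalence, and the unit circle is not
  contractible.\<close>

lemma circle_model_nontrivial:
  assumes "circle_model S"
  obtains n s where "s \<in> cells S n" "s \<noteq> pt S n"
proof -
  have "\<not> contractible (sphere (0::complex) 1)" by (simp add: contractible_sphere)
  moreover have "realization S homotopy_equivalent_space top_of_set (sphere (0::complex) 1)"
    and S: "pointed_sset S"
    using assms by (simp_all add: circle_model_def)
  ultimately have "\<not> contractible_space (realization S)"
    by (simp add: homotopy_equivalent_space_contractibility)
  then show ?thesis using realization_of_point[OF S] that by blast
qed

text \<open>Each property passes through one more application of \<open>Susp\<close>, by induction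
  on \<open>r\<close> from the identity functor. Equalizers stay in levelwise form so that the
  conclusion of one step is the premise of the next.\<close>

lemma adj_power_susp_loop:
  assumes S: "pointed_sset S" and s0: "s0 \<in> cells S n0" "s0 \<noteq> pt S n0"
  defines "A \<equiv> adj_power sSet_pt (susp_loop S)"
  shows "adjunction sSet_pt sSet_pt (A r)"
    and "levelwise_equalizer e f g \<Longrightarrow>
      levelwise_equalizer (on_arr (ladj (A r)) e) (on_arr (ladj (A r)) f) (on_arr (ladj (A r)) g)"
    and "f \<in> Arr sSet_pt \<Longrightarrow> is_iso sSet_pt (on_arr (ladj (A r)) f) \<Longrightarrow> is_iso sSet_pt f"
proof -
  show adj: "adjunction sSet_pt sSet_pt (A r)" for r
  proof (induction r)
    case 0
    show ?case by (simp add: A_def sSet.adjunction_id_adj)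
  next
    case (Suc r)
    then show ?case
      using adjunction_comp_adj[OF _ adjunction_susp_loop[OF S] category_sSet_pt category_sSet_pt category_sSet_pt]
      by (simp add: A_def)
  qed
  have L: "ladj (A 0) = id_fctr" "ladj (A (Suc r)) = comp_fctr (Susp S) (ladj (A r))" for r
    by (simp_all add: A_def id_adj_def comp_adj_def susp_loop_def)
  show "levelwise_equalizer e f g \<Longrightarrow>
      levelwise_equalizer (on_arr (ladj (A r)) e) (on_arr (ladj (A r)) f) (on_arr (ladj (A r)) g)"
    by (induction r) (simp_all add: L levelwise_equalizer_Susp[OF S])
  show "is_iso sSet_pt (on_arr (ladj (A r)) f) \<Longrightarrow> is_iso sSet_pt f" if f: "f \<in> Arr sSet_pt"
  proof (induction r)
    case 0
    then show ?case by (simp add: L)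
  next
    case (Suc r)
    interpret F: cat_functor sSet_pt sSet_pt "ladj (A r)"
      using adj by (simp add: adjunction_def)
    \<comment> \<open>Reflection is peeled off from the outside: \<open>Susp\<close> is applied
      last, so it reflects first, and it needs an arrow as argument.\<close>
    have Lf: "on_arr (ladj (A r)) f \<in> Arr sSet_pt"
      using F.on_arr_Hom f by (auto simp: Hom_def)
    show ?case using Suc Susp_reflects_iso[OF S s0 Lf] by (simp add: L)
  qed
qed

text \<open>The criterion is instantiated with \<open>ps_equalizer\<close>, whose levelwise property
  survives all \<open>r\<close> suspensions and only then is turned into the universal
  property.\<close>

theorem proposition2p2p3:
  fixes S :: "'s psset" and r :: nat
    and A :: "(('s, 'v) uobj, ('s, 'v) umor, ('s, 'v) uobj, ('s, 'v) umor) adj"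
  assumes "circle_model S"
    and "A = adj_power sSet_pt (susp_loop S) r"
  shows "adjunction sSet_pt sSet_pt A \<and> comonadic sSet_pt sSet_pt A \<and>
         adjoint_equivalence sSet_pt (coAlg sSet_pt (comonad_of A))
           (comparison_adj sSet_pt sSet_pt A ps_equalizer)"
proof -
  obtain n0 s0 where s0: "s0 \<in> cells S n0" "s0 \<noteq> pt S n0"
    using circle_model_nontrivial[OF assms(1)] .
  have S: "pointed_sset S" using assms(1) by (simp add: circle_model_def)
  note A = adj_power_susp_loop[OF S s0, where r=r]
  interpret comonadicity_criterion sSet_pt sSet_pt A ps_equalizer
  proof (unfold_locales, goal_cases)
    case 1
    show ?case unfolding assms(2) by (rule A(1))
  next
    case (2 f X Y g)
    then show ?case by (intro levelwise_equalizer_imp_equalizer levelwise_equalizer_ps_equalizer)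
  next
    case (3 f X Y g)
    then show ?case
      unfolding assms(2) by (intro levelwise_equalizer_imp_equalizer A(2) levelwise_equalizer_ps_equalizer)
  next
    case (4 f)
    then show ?case unfolding assms(2) by (rule A(3))
  qed
  show ?thesis
    using adjunction comonadic adjoint_equivalence_comparison by blast
qed

end
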